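(* Let $a_1,\dots,a_s$ be positive integers with $\max\{a_1,\dots,a_s\} = 7$ and let $m = \sum_{i=1}^{s}(a_i - 1) + 1$. If $m \ge 13$, then $$F_v(a_1, \dots, a_s; 8) \ge 3m - 10.$$
   Context: All graphs are finite, simple and undirected; $\omega(G)$ denotes the clique number. $G \overset{v}{\rightarrow} (a_1, \dots, a_s)$ means that for every coloring of the vertices of $G$ in $s$ colors there exists $i$ such that $G$ contains an $a_i$-clique all of whose vertices have color $i$. The vertex Folkman number is $F_v(a_1, \dots, a_s; q) = \min\{|V(G)| : G \overset{v}{\rightarrow} (a_1,\dots,a_s) \text{ and } \omega(G) < q\}$. *)

theory Defs
  imports "HOL-Library.Ramsey" "HOL-Library.Extended_Nat"
begin

text \<open>A finite simple undirected graph is a pair of a vertex set \<open>V\<close> and a set \<open>E\<close> of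
  two-element subsets of \<open>V\<close>. Cliques are those of theory \<open>Ramsey\<close>, where
  \<open>clique K E\<close> says that any two distinct elements of \<open>K\<close> are joined by an edge in \<open>E\<close>.\<close>

definition simple_graph :: "'a set \<Rightarrow> 'a set set \<Rightarrow> bool" where
  "simple_graph V E \<longleftrightarrow> finite V \<and> E \<subseteq> nsets V 2"

definition clique_number :: "'a set \<Rightarrow> 'a set set \<Rightarrow> nat" where
  "clique_number V E = Max {card K | K. K \<subseteq> V \<and> clique K E}"

text \<open>The tuple \<open>(a\<^sub>1, \<dots>, a\<^sub>s)\<close> is a list of length \<open>s\<close>, and the colors are the list
  positions \<open>0, \<dots>, s - 1\<close>.\<close>

definition vertex_arrows :: "'a set \<Rightarrow> 'a set set \<Rightarrow> nat list \<Rightarrow> bool" where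
  "vertex_arrows V E a \<longleftrightarrow>
     (\<forall>c \<in> V \<rightarrow> {..<length a}. \<exists>i<length a. \<exists>K\<subseteq>V.
        clique K E \<and> card K = a ! i \<and> (\<forall>v\<in>K. c v = i))"

text \<open>Every finite graph is isomorphic to one whose vertices are natural numbers, so the minimum
  may be taken over those. It is taken in \<open>enat\<close>, so that it is infinite in the case
  (\<open>q \<le> max {a\<^sub>1, \<dots>, a\<^sub>s}\<close>) where no graph qualifies.\<close>

definition vertex_Folkman :: "nat list \<Rightarrow> nat \<Rightarrow> enat" where
  "vertex_Folkman a q =
     Inf {enat (card V) | (V :: nat set) E.
            simple_graph V E \<and> vertex_arrows V E a \<and> clique_number V E < q}"

end

theory Submission
  imports Defs
begin

text \<open>We work in the complement graph, whose edges are given by \<open>R\<close>; color classes without a 2-clique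
  are cliques there. Fix an entry 7 of the list. Using \<open>a\<^sub>i - 1\<close> cliques of the complement for each other
  color \<open>i\<close>, one gets from the arrow relation the property \<open>folk 7 (m - 7) V\<close>: independent sets have at most 7
  vertices, and an independent 7-set survives the removal of any \<open>m - 7\<close> cliques. With \<open>j = m - 7\<close>,
  the claim is \<open>card V \<ge> 3 * j + 11\<close> for \<open>j \<ge> 6\<close>. Removing a clique lowers \<open>j\<close> by one, so each
  triangle gains three vertices, and everything depends on nearly triangle-free graphs.

  The main tool is \<open>closed_neighbourhood_cover\<close>: covering the closed neighbourhood of an independent set
  \<open>S\<close> takes at least \<open>j + card S\<close> cliques. For \<open>j \<ge> 7\<close> it gives every vertex 8 neighbours, so there is
  a triangle. For \<open>j = 6\<close> two nonadjacent vertices with independent neighbourhoods have at most one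
  common neighbour, which is impossible for a triangle-free graph on at most 28 vertices; it is also
  impossible if any two triangles meet and there is no 4-clique. For \<open>j \<le> 5\<close> the bounds 15, 17, 20, 23, 25
  are used. The critical cases are triangle-free with 19 (\<open>j = 3\<close>) or 22 (\<open>j = 4\<close>) vertices; there the
  graph has an (almost) perfect matching, and following forced choices of endpoints in an independent
  transversal of matching edges leads to an independent set that is too large.\<close>

section \<open>Hall's marriage theorem\<close>

lemma hall:
  fixes N :: "'a \<Rightarrow> 'b set"
  assumes "finite A" "\<And>x. x \<in> A \<Longrightarrow> finite (N x)"
    and "\<And>S. S \<subseteq> A \<Longrightarrow> card S \<le> card (\<Union>(N ` S))"
  shows "\<exists>f. inj_on f A \<and> (\<forall>x\<in>A. f x \<in> N x)"
  using assms
proof (induction "card A" arbitrary: A N rule: less_induct)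
  case less
  note fA = less.prems(1) and fN = less.prems(2) and hallA = less.prems(3)
  show ?case
  proof (cases "\<exists>S. S \<subset> A \<and> S \<noteq> {} \<and> card (\<Union>(N ` S)) = card S")
    case True
    then obtain S where S: "S \<subset> A" "S \<noteq> {}" "card (\<Union>(N ` S)) = card S" by blast
    let ?U = "\<Union>(N ` S)"
    have fS: "finite S" using S(1) fA finite_subset by blast
    have fU: "finite ?U" using S(1) fS fN by blast
    obtain f where f: "inj_on f S" "\<forall>x\<in>S. f x \<in> N x"
      using less.hyps[of S N] S(1) fS fA fN hallA psubset_card_mono[OF fA S(1)] by blast
    \<comment> \<open>\<open>S\<close> is tight, so for \<open>T\<close> disjoint from
      \<open>S\<close> Hall's condition for \<open>S \<union> T\<close> leaves at least
      \<open>card T\<close> neighbours outside \<open>?U\<close>.\<close>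
    have "\<exists>g. inj_on g (A - S) \<and> (\<forall>x\<in>A - S. g x \<in> N x - ?U)"
    proof (rule less.hyps)
      show "card (A - S) < card A"
        using S(1,2) fA by (intro psubset_card_mono) auto
      fix T assume T: "T \<subseteq> A - S"
      have fT: "finite T" using T fA finite_subset by blast
      have "card (S \<union> T) = card S + card T"
        using T fS fT by (subst card_Un_disjoint) auto
      moreover have "card (S \<union> T) \<le> card (\<Union>(N ` (S \<union> T)))"
        using hallA[of "S \<union> T"] T S(1) by blast
      moreover have "\<Union>(N ` (S \<union> T)) = ?U \<union> (\<Union>x\<in>T. N x - ?U)" by blast
      moreover have "card (?U \<union> (\<Union>x\<in>T. N x - ?U)) = card ?U + card (\<Union>x\<in>T. N x - ?U)"
        using fU fT T fN by (intro card_Un_disjoint) auto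
      ultimately show "card T \<le> card (\<Union>x\<in>T. N x - ?U)" using S(3) by simp
    qed (use fA fN in auto)
    then obtain g where g: "inj_on g (A - S)" "\<forall>x\<in>A - S. g x \<in> N x - ?U" by blast
    let ?h = "\<lambda>x. if x \<in> S then f x else g x"
    have "inj_on ?h A"
    proof -
      have "f ` S \<inter> g ` (A - S) = {}" using f(2) g(2) by fastforce
      then have "inj_on (\<lambda>x. if x \<in> S then f x else g x) (S \<union> (A - S))"
        using f(1) g(1) by (auto simp: inj_on_def)
      moreover have "S \<union> (A - S) = A" using S(1) by blast
      ultimately show ?thesis by simp
    qed
    moreover have "\<forall>x\<in>A. ?h x \<in> N x" using f g by auto
    ultimately show ?thesis by blast
  next
    case nt: False
    show ?thesis
    proof (cases "A = {}")
      case True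
      then show ?thesis by simp
    next
      case ne: False
      then obtain a where a: "a \<in> A" by blast
      have "N a \<noteq> {}" using hallA[of "{a}"] a by auto
      then obtain b where b: "b \<in> N a" by blast
      \<comment> \<open>Without tight sets, every nonempty proper subset has a neighbour to spare,
        so losing the single value \<open>b\<close> is harmless.\<close>
      have "\<exists>g. inj_on g (A - {a}) \<and> (\<forall>x\<in>A - {a}. g x \<in> N x - {b})"
      proof (rule less.hyps)
        show "card (A - {a}) < card A" using a fA by (metis card_Diff1_less)
        fix T assume T: "T \<subseteq> A - {a}"
        have fT: "finite T" using T fA finite_subset by blast
        have fUT: "finite (\<Union>(N ` T))" using fT T fN by blast
        have eq: "(\<Union>x\<in>T. N x - {b}) = \<Union>(N ` T) - {b}" by blast
        show "card T \<le> card (\<Union>x\<in>T. N x - {b})"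
        proof (cases "T = {}")
          case False
          have "T \<subset> A" using T a by blast
          then have "card T \<noteq> card (\<Union>(N ` T))" using nt False by metis
          moreover have "card T \<le> card (\<Union>(N ` T))" using hallA[of T] T by blast
          ultimately have "card T < card (\<Union>(N ` T))" by simp
          moreover have "card (\<Union>(N ` T)) \<le> Suc (card (\<Union>(N ` T) - {b}))"
            using card_Suc_Diff1[OF fUT, of b] by (cases "b \<in> \<Union>(N ` T)") auto
          ultimately show ?thesis unfolding eq by linarith
        qed simp
      qed (use fA fN in auto)
      then obtain g where g: "inj_on g (A - {a})" "\<forall>x\<in>A - {a}. g x \<in> N x - {b}" by blast
      have "inj_on (g(a := b)) A"
        using g a unfolding inj_on_def by auto
      moreover have "\<forall>x\<in>A. (g(a := b)) x \<in> N x" using g b by auto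
      ultimately show ?thesis by blast
    qed
  qed
qed

section \<open>Independent sets, cliques and the property \<open>folk\<close>\<close>

locale irreflexive_symmetric =
  fixes R :: "'a \<Rightarrow> 'a \<Rightarrow> bool"
  assumes R_sym: "R x y \<Longrightarrow> R y x" and R_irrefl: "\<not> R x x"
begin

definition indep :: "'a set \<Rightarrow> bool" where
  "indep I \<longleftrightarrow> (\<forall>x\<in>I. \<forall>y\<in>I. \<not> R x y)"

definition clq :: "'a set \<Rightarrow> bool" where
  "clq K \<longleftrightarrow> (\<forall>x\<in>K. \<forall>y\<in>K. x \<noteq> y \<longrightarrow> R x y)"

definition nb :: "'a set \<Rightarrow> 'a \<Rightarrow> 'a set" where
  "nb V v = {w \<in> V. R v w}"

definition triangle_free :: "'a set \<Rightarrow> bool" where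
  "triangle_free V \<longleftrightarrow> (\<forall>x\<in>V. \<forall>y\<in>V. \<forall>z\<in>V. \<not> (R x y \<and> R y z \<and> R x z))"

definition folk :: "nat \<Rightarrow> nat \<Rightarrow> 'a set \<Rightarrow> bool" where
  "folk p j V \<longleftrightarrow> finite V \<and> (\<forall>I\<subseteq>V. indep I \<longrightarrow> card I \<le> p) \<and>
     (\<forall>Q. finite Q \<and> card Q \<le> j \<and> (\<forall>K\<in>Q. clq K) \<longrightarrow>
        (\<exists>I\<subseteq>V. indep I \<and> card I = p \<and> I \<inter> \<Union>Q = {}))"

lemma folk_finite: "folk p j V \<Longrightarrow> finite V"
  by (simp add: folk_def)

lemma folk_le: "folk p j V \<Longrightarrow> I \<subseteq> V \<Longrightarrow> indep I \<Longrightarrow> card I \<le> p"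
  by (simp add: folk_def)

lemma folkE:
  assumes "folk p j V" "finite Q" "card Q \<le> j" "\<And>K. K \<in> Q \<Longrightarrow> clq K"
  obtains I where "I \<subseteq> V" "indep I" "card I = p" "I \<inter> \<Union>Q = {}"
  using assms unfolding folk_def by blast

lemma folk_mono: "folk p j V \<Longrightarrow> i \<le> j \<Longrightarrow> folk p i V"
  unfolding folk_def by (meson order_trans)

lemma folk_peel:
  assumes "folk p (Suc j) V" "clq K"
  shows "folk p j (V - K)"
  unfolding folk_def
proof (intro conjI allI impI)
  show "finite (V - K)" using folk_finite[OF assms(1)] by simp
  show "card I \<le> p" if "I \<subseteq> V - K" "indep I" for I
    using folk_le[OF assms(1)] that by blast
  fix Q assume Q: "finite Q \<and> card Q \<le> j \<and> (\<forall>K\<in>Q. clq K)"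
  have "card (insert K Q) \<le> Suc j" using Q by (auto simp: card_insert_if)
  then obtain I where "I \<subseteq> V" "indep I" "card I = p" "I \<inter> \<Union>(insert K Q) = {}"
    using folkE[OF assms(1), of "insert K Q"] Q assms(2) by blast
  then show "\<exists>I\<subseteq>V - K. indep I \<and> card I = p \<and> I \<inter> \<Union>Q = {}" by blast
qed

lemma indep_subset: "indep I \<Longrightarrow> J \<subseteq> I \<Longrightarrow> indep J"
  unfolding indep_def by blast

lemma indep_Un: 
  "indep I \<Longrightarrow> indep J \<Longrightarrow> (\<And>x y. x \<in> I \<Longrightarrow> y \<in> J \<Longrightarrow> \<not> R x y) \<Longrightarrow> indep (I \<union> J)"
  unfolding indep_def using R_sym by blast

text \<open>A clique meets \<open>X\<close> in at most one vertex, so choosing a clique of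
  \<open>Q\<close> through each vertex is injective.\<close>

lemma indep_card_le_cliques:
  assumes "indep X" "finite Q" "\<And>K. K \<in> Q \<Longrightarrow> clq K" "X \<subseteq> \<Union>Q"
  shows "card X \<le> card Q"
proof -
  define g where "g x = (SOME K. K \<in> Q \<and> x \<in> K)" for x
  have g: "g x \<in> Q \<and> x \<in> g x" if "x \<in> X" for x
    unfolding g_def by (rule someI_ex) (use that assms(4) in blast)
  have "inj_on g X"
  proof (rule inj_onI)
    fix x y assume xy: "x \<in> X" "y \<in> X" "g x = g y"
    have "clq (g x)" "x \<in> g x" "y \<in> g x" using g[OF xy(1)] g[OF xy(2)] xy(3) assms(3) by simp_all
    then show "x = y" using xy assms(1) unfolding clq_def indep_def by blast
  qed
  then show ?thesis using g assms(2) by (meson card_inj_on_le image_subsetI)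
qed

text \<open>Remove \<open>j\<close> of the cliques: a surviving independent \<open>p\<close>-set meets the closed neighbourhood of
  \<open>S\<close> in fewer than \<open>card S\<close> vertices, and exchanging those for \<open>S\<close> makes it larger.\<close>

lemma closed_neighbourhood_cover:
  assumes V: "folk p j V" and S: "S \<subseteq> V" "indep S" "S \<noteq> {}"
    and Q: "finite Q" "\<And>K. K \<in> Q \<Longrightarrow> clq K"
    and cover: "\<And>x. x \<in> V \<Longrightarrow> x \<in> S \<or> (\<exists>s\<in>S. R s x) \<Longrightarrow> x \<in> \<Union>Q"
  shows "j + card S \<le> card Q"
proof (rule ccontr)
  assume "\<not> ?thesis"
  then have less: "card Q < j + card S" by simp
  have fV: "finite V" using V by (rule folk_finite)
  have fS: "finite S" using S(1) fV finite_subset by blast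
  \<comment> \<open>The minimum allows for fewer than \<open>j\<close> cliques, in which case all of
    \<open>Q\<close> is removed.\<close>
  obtain P where P: "P \<subseteq> Q" "card P = min j (card Q)"
    by (meson min.cobounded2 obtain_subset_with_card_n)
  have fP: "finite P" using P Q finite_subset by blast
  obtain I where I: "I \<subseteq> V" "indep I" "card I = p" "I \<inter> \<Union>P = {}"
    using folkE[OF V fP] P Q by (metis min.cobounded1 subsetD)
  have fI: "finite I" using I(1) fV finite_subset by blast
  define N where "N = {x \<in> V. x \<in> S \<or> (\<exists>s\<in>S. R s x)}"
  have "card (I \<inter> N) \<le> card (Q - P)"
  proof (rule indep_card_le_cliques)
    show "indep (I \<inter> N)" using I(2) indep_subset by blast
    show "I \<inter> N \<subseteq> \<Union>(Q - P)" using cover I(4) unfolding N_def by blast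
  qed (use Q in auto)
  also have "card (Q - P) < card S"
    using less P card_Diff_subset[OF fP P(1)] S(3) fS by (auto simp: min_def card_gt_0_iff)
  finally have "card (I \<inter> N) < card S" .
  moreover have "card I = card (I \<inter> N) + card (I - N)"
    using fI by (simp add: card_Int_Diff)
  moreover have "card ((I - N) \<union> S) = card (I - N) + card S"
    using fI fS S(1) by (intro card_Un_disjoint) (auto simp: N_def)
  moreover have "indep ((I - N) \<union> S)"
    using I S by (intro indep_Un) (auto intro: indep_subset simp: N_def dest: R_sym)
  then have "card ((I - N) \<union> S) \<le> p" using I(1) S(1) by (intro folk_le[OF V]) auto
  ultimately show False using I(3) by simp
qed

text \<open>Keep \<open>p\<close> of the \<open>p + j\<close> cliques, among them \<open>E\<close>,
  and delete the others. A surviving independent \<open>p\<close>-set is covered by the kept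
  cliques, so it has a vertex in each.\<close>

lemma tight_cover_transversal:
  assumes V: "folk p j V" and C: "finite C" "\<And>K. K \<in> C \<Longrightarrow> clq K" "V \<subseteq> \<Union>C" "card C = p + j"
    and E: "E \<subseteq> C" "card E \<le> p"
  obtains I where "I \<subseteq> V" "indep I" "card I = p" "\<And>K. K \<in> E \<Longrightarrow> I \<inter> K \<noteq> {}"
proof -
  have fE: "finite E" using E C finite_subset by blast
  have "p - card E \<le> card (C - E)" using card_Diff_subset[OF fE E(1)] C(4) by simp
  then obtain F0 where F0: "F0 \<subseteq> C - E" "card F0 = p - card E"
    by (meson obtain_subset_with_card_n)
  define F where "F = E \<union> F0"
  have fF: "finite F" "F \<subseteq> C" using F0 fE C(1) E finite_subset unfolding F_def by blast+
  have cF: "card F = p"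
    unfolding F_def using F0 E fE C(1)
    by (subst card_Un_disjoint) (auto intro: finite_subset)
  have "card (C - F) \<le> j" using card_Diff_subset[OF fF] cF C(4) by simp
  then obtain I where I: "I \<subseteq> V" "indep I" "card I = p" "I \<inter> \<Union>(C - F) = {}"
    using folkE[OF V, of "C - F"] C by blast
  have "I \<inter> K \<noteq> {}" if "K \<in> E" for K
  proof
    assume K: "I \<inter> K = {}"
    have "K \<in> F" using that F_def by blast
    have "card I \<le> card (F - {K})"
    proof (rule indep_card_le_cliques)
      show "I \<subseteq> \<Union>(F - {K})"
      proof
        fix x assume "x \<in> I"
        then obtain L where "L \<in> C" "x \<in> L" using I(1) C(3) by blast
        then show "x \<in> \<Union>(F - {K})" using \<open>x \<in> I\<close> I(4) K by blast
      qed
    qed (use I fF C in auto)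
    then show False using I(3) cF \<open>K \<in> F\<close> fF(1)
      by (metis card_Diff1_less linorder_not_le)
  qed
  then show thesis using I that by blast
qed

text \<open>One edge at \<open>v\<close> and singletons for the other neighbours cover the closed
  neighbourhood with as many cliques as \<open>v\<close> has neighbours;
  \<open>closed_neighbourhood_cover\<close> asks for \<open>j + 1\<close>.\<close>

lemma folk_degree_ge:
  assumes "folk p j V" "v \<in> V" "j \<ge> 1"
  shows "j + 1 \<le> card (nb V v)"
proof -
  have f: "finite (nb V v)" using folk_finite[OF assms(1)] unfolding nb_def by simp
  show ?thesis
  proof (cases "nb V v = {}")
    case True
    have "j + card {v} \<le> card {{v}}"
      by (rule closed_neighbourhood_cover[OF assms(1)])
        (use assms True in \<open>auto simp: indep_def clq_def nb_def R_irrefl\<close>)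
    then show ?thesis using assms(3) by simp
  next
    case False
    then obtain n where n: "n \<in> nb V v" by blast
    let ?Q = "insert {v, n} ((\<lambda>x. {x}) ` (nb V v - {n}))"
    have "j + card {v} \<le> card ?Q"
      by (rule closed_neighbourhood_cover[OF assms(1)])
        (use assms n f in \<open>auto simp: indep_def clq_def nb_def R_irrefl R_sym\<close>)
    also have "card ?Q \<le> Suc (card ((\<lambda>x. {x}) ` (nb V v - {n})))"
      by (rule card_insert_le_m1) auto
    also have "\<dots> \<le> Suc (card (nb V v - {n}))" using f by (simp add: card_image_le)
    also have "\<dots> = card (nb V v)" using n f by (metis card_Suc_Diff1)
    finally show ?thesis by simp
  qed
qed

section \<open>Matchings from maximum independent sets, and the case \<open>j = 1\<close>\<close>

text \<open>Exchanging the neighbours of \<open>S\<close> in \<open>B\<close> for \<open>S\<close>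
  itself cannot enlarge \<open>B\<close>, which is Hall's condition.\<close>

lemma max_indep_matching:
  assumes "finite B" and max: "\<And>I. I \<subseteq> A \<union> B \<Longrightarrow> indep I \<Longrightarrow> card I \<le> card B"
    and "indep A" "indep B" "finite A"
  obtains f where "inj_on f (A - B)" "\<And>x. x \<in> A - B \<Longrightarrow> f x \<in> B - A \<and> R x (f x)"
proof -
  have "\<exists>f. inj_on f (A - B) \<and> (\<forall>x\<in>A - B. f x \<in> {y \<in> B. R x y})"
  proof (rule hall)
    fix S assume S: "S \<subseteq> A - B"
    have fS: "finite S" using S assms(5) finite_subset by blast
    let ?N = "\<Union>((\<lambda>x. {y \<in> B. R x y}) ` S)"
    have "card ((B - ?N) \<union> S) \<le> card B"
    proof (rule max)
      show "indep ((B - ?N) \<union> S)"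
        using S assms(3,4) by (intro indep_Un) (auto intro: indep_subset dest: R_sym)
    qed (use S in blast)
    moreover have "card ((B - ?N) \<union> S) = card (B - ?N) + card S"
      using S fS assms(1) by (intro card_Un_disjoint) auto
    moreover have "card (B - ?N) = card B - card ?N"
      using assms(1) by (intro card_Diff_subset) (auto intro: finite_subset)
    moreover have "card ?N \<le> card B" using assms(1) by (intro card_mono) auto
    ultimately show "card S \<le> card ?N" by simp
  qed (use assms in auto)
  then obtain f where f: "inj_on f (A - B)" "\<forall>x\<in>A - B. f x \<in> {y \<in> B. R x y}" by blast
  have "f x \<in> B - A \<and> R x (f x)" if "x \<in> A - B" for x
    using that f(2) assms(3) unfolding indep_def by fastforce
  then show thesis using f(1) that by blast
qed

text \<open>For independent \<open>p\<close>-sets \<open>J\<^sub>1, J\<^sub>2, \<dots>\<close> without a common element in \<open>S\<close>, let \<open>D\<^sub>i\<close> be the elements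
  of \<open>S\<close> in \<open>J\<^sub>1, \<dots>, J\<^sub>i\<^sub>-\<^sub>1\<close> but not in \<open>J\<^sub>i\<close>. The neighbours of \<open>D\<^sub>i\<close> in \<open>J\<^sub>i\<close> are at least as many as
  \<open>D\<^sub>i\<close>, and they avoid the earlier sets.\<close>

lemma neighbours_of_uncommon:
  assumes "finite V" and max: "\<And>I. I \<subseteq> V \<Longrightarrow> indep I \<Longrightarrow> card I \<le> p"
    and "finite F" "\<And>J. J \<in> F \<Longrightarrow> J \<subseteq> V \<and> indep J \<and> card J = p"
    and "S \<subseteq> V" "indep S" "S \<inter> \<Inter>F = {}"
  shows "card S \<le> card ({w \<in> V. \<exists>s\<in>S. R s w} \<inter> \<Union>F)"
  using assms(3-)
proof (induction F arbitrary: S rule: finite_induct)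
  case empty
  \<comment> \<open>\<open>\<Inter>{}\<close> is the whole type, so \<open>S\<close> is
    empty.\<close>
  then show ?case by simp
next
  case (insert J F)
  let ?N = "\<lambda>S. {w \<in> V. \<exists>s\<in>S. R s w}"
  define D where "D = S \<inter> \<Inter>F"
  have J: "J \<subseteq> V" "indep J" "card J = p" using insert.prems(1) by auto
  have fS: "finite S" using insert.prems(2) assms(1) finite_subset by blast
  have D: "D \<subseteq> S" "D \<inter> J = {}" using insert.prems(4) unfolding D_def by auto
  have 1: "card (S - D) \<le> card (?N (S - D) \<inter> \<Union>F)"
    using insert.prems indep_subset by (intro insert.IH) (auto simp: D_def)
  obtain f where f: "inj_on f (D - J)" "\<And>x. x \<in> D - J \<Longrightarrow> f x \<in> J - D \<and> R x (f x)"
    using max_indep_matching[of J D] J D insert.prems(2,3) max fS assms(1)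
    by (smt (verit) finite_subset indep_subset le_sup_iff order_trans)
  have DJ: "D - J = D" using D by blast
  have 2: "card D \<le> card (?N D \<inter> J)"
  proof (rule card_inj_on_le)
    show "inj_on f D" using f(1) DJ by simp
    show "f ` D \<subseteq> ?N D \<inter> J" using f(2) DJ J(1) by blast
    show "finite (?N D \<inter> J)" using assms(1) by auto
  qed
  have 3: "?N D \<inter> \<Union>F = {}"
  proof -
    have False if "w \<in> K" "K \<in> F" "s \<in> D" "R s w" for w K s
      using that insert.prems(1) unfolding D_def indep_def by blast
    then show ?thesis by blast
  qed
  have "card S = card (S - D) + card D"
    using D fS by (metis card_Diff_subset card_mono finite_subset le_add_diff_inverse2)
  also have "\<dots> \<le> card (?N (S - D) \<inter> \<Union>F) + card (?N D \<inter> J)" using 1 2 by simp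
  also have "\<dots> = card ((?N (S - D) \<inter> \<Union>F) \<union> (?N D \<inter> J))"
    using 3 assms(1) by (intro card_Un_disjoint[symmetric]) auto
  also have "\<dots> \<le> card (?N S \<inter> \<Union>(insert J F))"
    using assms(1) D by (intro card_mono) auto
  finally show ?case .
qed

text \<open>Some independent \<open>p\<close>-set survives the deletion of any single vertex, so no
  vertex lies in all of them, and \<open>neighbours_of_uncommon\<close> supplies Hall's
  condition.\<close>

lemma indep_injects:
  assumes V: "folk p 1 V" and I: "I \<subseteq> V" "indep I" 
  obtains f where "inj_on f I" "\<And>x. x \<in> I \<Longrightarrow> f x \<in> V - I \<and> R x (f x)"
proof -
  have fV: "finite V" using V by (rule folk_finite)
  define F where "F = {J. J \<subseteq> V \<and> indep J \<and> card J = p}"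
  have "finite F" unfolding F_def using fV by (simp add: finite_subset[of _ "Pow V"])
  have noncommon: "v \<notin> \<Inter>F" for v
  proof -
    obtain J where "J \<subseteq> V" "indep J" "card J = p" "J \<inter> \<Union>{{v}} = {}"
      by (rule folkE[OF V, of "{{v}}"]) (auto simp: clq_def)
    then show ?thesis unfolding F_def by blast
  qed
  have "\<exists>f. inj_on f I \<and> (\<forall>x\<in>I. f x \<in> nb V x)"
  proof (rule hall)
    fix S assume S: "S \<subseteq> I"
    have "card S \<le> card ({w \<in> V. \<exists>s\<in>S. R s w} \<inter> \<Union>F)"
    proof (rule neighbours_of_uncommon[where p = p])
      show "S \<inter> \<Inter>F = {}" using noncommon by blast
    qed (use S I \<open>finite F\<close> fV folk_le[OF V] indep_subset in \<open>auto simp: F_def\<close>)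
    also have "\<dots> \<le> card (\<Union>(nb V ` S))"
    proof (rule card_mono)
      show "finite (\<Union>(nb V ` S))" using fV by (rule rev_finite_subset) (auto simp: nb_def)
    qed (auto simp: nb_def)
    finally show "card S \<le> card (\<Union>(nb V ` S))" .
  qed (use fV I finite_subset in \<open>auto simp: nb_def\<close>)
  then obtain f where f: "inj_on f I" "\<forall>x\<in>I. f x \<in> nb V x" by blast
  have "f x \<in> V - I \<and> R x (f x)" if "x \<in> I" for x
    using that f(2) I(2) unfolding indep_def nb_def by blast
  then show thesis using f(1) that by blast
qed

text \<open>An independent \<open>p\<close>-set is matched into the rest. If there were no further
  vertex, the \<open>p\<close> matching edges would cover its closed neighbourhood, against
  \<open>closed_neighbourhood_cover\<close>.\<close>

lemma folk_one_bound:
  assumes V: "folk p 1 V" and "p \<ge> 1"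
  shows "2 * p + 1 \<le> card V"
proof -
  have fV: "finite V" using V by (rule folk_finite)
  obtain I where I: "I \<subseteq> V" "indep I" "card I = p"
    by (rule folkE[OF V, of "{}"]) auto
  have fI: "finite I" using I(1) fV finite_subset by blast
  obtain f where f: "inj_on f I" "\<And>x. x \<in> I \<Longrightarrow> f x \<in> V - I \<and> R x (f x)"
    using indep_injects[OF V I(1,2)] by blast
  have sub: "I \<union> f ` I \<subseteq> V" using I f by blast
  have card: "card (I \<union> f ` I) = 2 * p"
    using fI f I(3) by (subst card_Un_disjoint) (auto simp: card_image)
  show ?thesis
  proof (rule ccontr)
    assume "\<not> ?thesis"
    then have eq: "I \<union> f ` I = V"
      using sub card fV by (intro card_seteq) auto
    have "1 + card I \<le> card ((\<lambda>x. {x, f x}) ` I)"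
    proof (rule closed_neighbourhood_cover[OF V I(1,2)])
      show "clq K" if "K \<in> (\<lambda>x. {x, f x}) ` I" for K
        using that f(2) R_sym unfolding clq_def by blast
      show "x \<in> \<Union>((\<lambda>x. {x, f x}) ` I)" if "x \<in> V" for x using that eq by blast
    qed (use fI I assms(2) in auto)
    then show False using card_image_le[OF fI, of "\<lambda>x. {x, f x}"] by simp
  qed
qed

section \<open>Peeling off edges and triangles\<close>

text \<open>Each unit of \<open>j\<close> costs at least two vertices. The premise
  \<open>i = Suc j\<close> is separate so that \<open>i\<close> can be a numeral.\<close>

lemma folk_peel_edge:
  assumes V: "folk p i V" and "i = Suc j" and "p \<ge> 1"
  obtains x y where "x \<in> V" "y \<in> V" "R x y" "folk p j (V - {x, y})" "card (V - {x, y}) + 2 = card V"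
proof -
  have V1: "folk p 1 V" using V assms(2) by (auto intro: folk_mono)
  have fV: "finite V" using V by (rule folk_finite)
  have "V \<noteq> {}" using folk_one_bound[OF V1 assms(3)] by auto
  then obtain x where x: "x \<in> V" by blast
  have "nb V x \<noteq> {}" using folk_degree_ge[OF V1 x] by auto
  then obtain y where y: "y \<in> V" "R x y" unfolding nb_def by blast
  have "clq {x, y}" using y R_sym unfolding clq_def by blast
  then have "folk p j (V - {x, y})" by (rule folk_peel[OF V[unfolded assms(2)]])
  moreover have "card (V - {x, y}) + 2 = card V"
  proof -
    have "x \<noteq> y" using y R_irrefl by blast
    then have "card {x, y} = 2" by simp
    moreover have "card {x, y} \<le> card V" using x y fV by (intro card_mono) auto
    ultimately show ?thesis using x y by (subst card_Diff_subset) auto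
  qed
  ultimately show thesis using x y that by blast
qed

lemma folk_peel_triangle:
  assumes V: "folk p i V" and "i = Suc j" and "\<not> triangle_free V"
  obtains x y z where "x \<in> V" "y \<in> V" "z \<in> V" "R x y" "R y z" "R x z"
    "folk p j (V - {x, y, z})" "card (V - {x, y, z}) + 3 = card V"
proof -
  have fV: "finite V" using V by (rule folk_finite)
  obtain x y z where xyz: "x \<in> V" "y \<in> V" "z \<in> V" "R x y" "R y z" "R x z"
    using assms(3) unfolding triangle_free_def by blast
  have "clq {x, y, z}" using xyz R_sym unfolding clq_def by blast
  then have "folk p j (V - {x, y, z})" by (rule folk_peel[OF V[unfolded assms(2)]])
  moreover have "card (V - {x, y, z}) + 3 = card V"
  proof -
    have "x \<noteq> y" "y \<noteq> z" "x \<noteq> z" using xyz R_irrefl by blast+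
    then have "card {x, y, z} = 3" by simp
    moreover have "card {x, y, z} \<le> card V" using xyz fV by (intro card_mono) auto
    ultimately show ?thesis using xyz by (subst card_Diff_subset) auto
  qed
  ultimately show thesis using xyz that by blast
qed

section \<open>Small triangle-free graphs\<close>

lemma triangle_free_subset: "triangle_free V \<Longrightarrow> W \<subseteq> V \<Longrightarrow> triangle_free W"
  unfolding triangle_free_def by blast

lemma indep_nb: "triangle_free V \<Longrightarrow> v \<in> V \<Longrightarrow> indep (nb V v)"
  unfolding triangle_free_def indep_def nb_def by blast

lemma triangle_free_pair:
  assumes "triangle_free X" "card X \<ge> 3"
  obtains x y where "x \<in> X" "y \<in> X" "x \<noteq> y" "\<not> R x y"
proof -
  obtain Y where "Y \<subseteq> X" "card Y = 3" using assms(2) by (meson obtain_subset_with_card_n)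
  then obtain x y z where "x \<in> X" "y \<in> X" "z \<in> X" "x \<noteq> y" "y \<noteq> z" "x \<noteq> z"
    unfolding card_3_iff by blast
  then show thesis using assms(1) that unfolding triangle_free_def by blast
qed

lemma indep_pair: "\<not> R x y \<Longrightarrow> indep {x, y}"
  using R_irrefl R_sym unfolding indep_def by blast

lemma indep_singleton: "indep {x}"
  using R_irrefl unfolding indep_def by blast

lemma triangle_free_card_le_2:
  assumes "triangle_free L" "\<And>X. X \<subseteq> L \<Longrightarrow> indep X \<Longrightarrow> card X \<le> 1"
  shows "card L \<le> 2"
proof (rule ccontr)
  assume "\<not> ?thesis"
  then obtain x y where "x \<in> L" "y \<in> L" "x \<noteq> y" "\<not> R x y"
    using triangle_free_pair[OF assms(1)] by (metis Suc_leI not_le numeral_2_eq_2 numeral_3_eq_3)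
  then show False using assms(2)[of "{x, y}"] indep_pair by simp
qed

text \<open>The Ramsey bound r(3,3) \<le> 6. The neighbours of a vertex \<open>w\<close> are
  independent, so at most two; its non-neighbours have independence number at most 1, so they are at
  most two as well.\<close>

lemma triangle_free_card_le_5:
  assumes "triangle_free L" "finite L" "\<And>X. X \<subseteq> L \<Longrightarrow> indep X \<Longrightarrow> card X \<le> 2"
  shows "card L \<le> 5"
proof (cases "L = {}")
  case False
  then obtain w where w: "w \<in> L" by blast
  define M where "M = L - insert w (nb L w)"
  have "card (nb L w) \<le> 2" 
    using indep_nb[OF assms(1) w] by (intro assms(3)) (auto simp: nb_def)
  moreover have "card M \<le> 2"
  proof (rule triangle_free_card_le_2)
    show "triangle_free M" using assms(1) unfolding M_def by (rule triangle_free_subset) blast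
    fix X assume X: "X \<subseteq> M" "indep X"
    have fX: "finite X" using X(1) assms(2) unfolding M_def using finite_subset by blast
    have "indep ({w} \<union> X)"
      using X indep_singleton by (intro indep_Un) (auto simp: M_def nb_def)
    then have "card (insert w X) \<le> 2" using X(1) w by (intro assms(3)) (auto simp: M_def)
    moreover have "w \<notin> X" using X(1) unfolding M_def by blast
    ultimately show "card X \<le> 1" using fX by simp
  qed
  moreover have "L = insert w (nb L w \<union> M)" using w unfolding M_def nb_def by blast
  then have "card L \<le> Suc (card (nb L w \<union> M))" by (metis card_insert_le_m1 diff_Suc_1 zero_less_Suc order_refl)
  moreover have "card (nb L w \<union> M) \<le> card (nb L w) + card M" by (rule card_Un_le)
  ultimately show ?thesis by simp
qed simp

section \<open>Matchings and forced vertices\<close>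

text \<open>A perfect matching of \<open>W\<close>, encoded by the involution that sends a vertex to
  its mate.\<close>

definition matching :: "'a set \<Rightarrow> ('a \<Rightarrow> 'a) \<Rightarrow> bool" where
  "matching W m \<longleftrightarrow> (\<forall>v\<in>W. m v \<in> W \<and> R v (m v) \<and> m (m v) = v)"

lemma matching_inj: "matching W m \<Longrightarrow> inj_on m W"
  unfolding matching_def by (metis inj_onI)

lemma matching_card_edges:
  assumes "finite W" "matching W m"
  shows "2 * card ((\<lambda>v. {v, m v}) ` W) = card W"
proof -
  have eq: "\<Union>((\<lambda>v. {v, m v}) ` W) = W" using assms(2) unfolding matching_def by blast
  have "2 * card ((\<lambda>v. {v, m v}) ` W) = card (\<Union>((\<lambda>v. {v, m v}) ` W))"
  proof (rule card_partition)
    show "finite (\<Union>((\<lambda>v. {v, m v}) ` W))" using assms(1) by simp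
    show "card c = 2" if c: "c \<in> (\<lambda>v. {v, m v}) ` W" for c
    proof -
      obtain v where "v \<in> W" "c = {v, m v}" using c by blast
      moreover have "v \<noteq> m v" using \<open>v \<in> W\<close> assms(2) R_irrefl unfolding matching_def by metis
      ultimately show ?thesis by simp
    qed
    show "c \<inter> d = {}" if cd: "c \<in> (\<lambda>v. {v, m v}) ` W" "d \<in> (\<lambda>v. {v, m v}) ` W" "c \<noteq> d" for c d
    proof -
      obtain v w where "v \<in> W" "c = {v, m v}" "w \<in> W" "d = {w, m w}" using cd by blast
      moreover have "m (m v) = v" "m (m w) = w"
        using calculation assms(2) unfolding matching_def by simp_all
      ultimately show ?thesis using cd(3) by (metis disjoint_iff doubleton_eq_iff empty_iff insert_iff)
    qed
  qed (use assms in auto)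
  then show ?thesis using eq by simp
qed

lemma matching_Un:
  assumes "matching A m" "matching B m'" "A \<inter> B = {}"
  shows "matching (A \<union> B) (\<lambda>v. if v \<in> A then m v else m' v)"
  using assms unfolding matching_def by fastforce

lemma matching_edge: "R x y \<Longrightarrow> matching {x, y} (\<lambda>v. if v = x then y else x)"
  using R_sym R_irrefl unfolding matching_def by auto

lemma matching_of_inj:
  assumes "inj_on f I" "\<And>x. x \<in> I \<Longrightarrow> f x \<notin> I \<and> R x (f x)"
  shows "matching (I \<union> f ` I) (\<lambda>v. if v \<in> I then f v else inv_into I f v)"
  unfolding matching_def
proof
  fix v assume "v \<in> I \<union> f ` I"
  then consider "v \<in> I" | x where "x \<in> I" "v = f x" "v \<notin> I" using assms(2) by blast
  then show "(if v \<in> I then f v else inv_into I f v) \<in> I \<union> f ` I \<and>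
      R v (if v \<in> I then f v else inv_into I f v) \<and>
      (if (if v \<in> I then f v else inv_into I f v) \<in> I
       then f (if v \<in> I then f v else inv_into I f v)
       else inv_into I f (if v \<in> I then f v else inv_into I f v)) = v"
  proof cases
    case 1
    then have "inv_into I f (f v) = v" "f v \<notin> I" "R v (f v)"
      using assms by (auto intro: inv_into_f_f)
    then show ?thesis using 1 by simp
  next
    case 2
    then have "inv_into I f v = x" "R v x"
      using assms R_sym by (auto intro: inv_into_f_f)
    then show ?thesis using 2 by simp
  qed
qed

text \<open>Every transversal of the matching edges through \<open>X\<close> that contains \<open>r\<close> and is independent is
  forced to contain certain vertices; \<open>k\<close> bounds the number of edges used to force \<open>x\<close>.\<close>

definition forced :: "'a set \<Rightarrow> ('a \<Rightarrow> 'a) \<Rightarrow> 'a \<Rightarrow> nat \<Rightarrow> 'a \<Rightarrow> bool" where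
  "forced W m r k x \<longleftrightarrow> (\<exists>X\<subseteq>W. finite X \<and> card X \<le> k \<and>
     (\<forall>I. indep I \<and> r \<in> I \<and> (\<forall>y\<in>X. y \<in> I \<or> m y \<in> I) \<longrightarrow> x \<in> I))"

text \<open>The bound \<open>k\<close> reflects that \<open>tight_cover_transversal\<close> handles
  only \<open>p\<close> cliques at a time. An element of \<open>X\<close> stands for the matching
  edge through it.\<close>

definition consistent :: "'a set \<Rightarrow> ('a \<Rightarrow> 'a) \<Rightarrow> 'a \<Rightarrow> nat \<Rightarrow> bool" where
  "consistent W m r k \<longleftrightarrow> (\<forall>X\<subseteq>W. finite X \<and> card X \<le> k \<longrightarrow>
     (\<exists>I. indep I \<and> r \<in> I \<and> (\<forall>y\<in>X. y \<in> I \<or> m y \<in> I)))"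

lemma forced_root: "forced W m r 0 r"
  unfolding forced_def by (rule exI[of _ "{}"]) auto

text \<open>An independent set through \<open>y\<close> misses \<open>b\<close>, so it can hit the
  edge at \<open>b\<close> only in \<open>m b\<close>; this spends one more edge.\<close>

lemma forced_step:
  assumes "forced W m r k y" "R y b" "b \<in> W"
  shows "forced W m r (Suc k) (m b)"
proof -
  obtain X where X: "X \<subseteq> W" "finite X" "card X \<le> k"
    "\<And>I. indep I \<Longrightarrow> r \<in> I \<Longrightarrow> (\<forall>y\<in>X. y \<in> I \<or> m y \<in> I) \<Longrightarrow> y \<in> I"
    using assms(1) unfolding forced_def by blast
  have "card (insert b X) \<le> Suc k" using X by (simp add: card_insert_if)
  moreover have "m b \<in> I" if "indep I" "r \<in> I" "\<forall>y\<in>insert b X. y \<in> I \<or> m y \<in> I" for I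
    using X(4)[of I] that assms(2) unfolding indep_def by blast
  ultimately show ?thesis
    unfolding forced_def using X assms(3) by (intro exI[of _ "insert b X"]) auto
qed

text \<open>Within the budget \<open>n\<close>, one independent set hits both forcing families and
  hence contains both vertices.\<close>

lemma forced_nonadjacent:
  assumes "forced W m r k x" "forced W m r l y" "consistent W m r n" "k + l \<le> n"
  shows "\<not> R x y"
proof -
  obtain X where X: "X \<subseteq> W" "finite X" "card X \<le> k"
    "\<And>I. indep I \<Longrightarrow> r \<in> I \<Longrightarrow> (\<forall>y\<in>X. y \<in> I \<or> m y \<in> I) \<Longrightarrow> x \<in> I"
    using assms(1) unfolding forced_def by blast
  obtain Y where Y: "Y \<subseteq> W" "finite Y" "card Y \<le> l"
    "\<And>I. indep I \<Longrightarrow> r \<in> I \<Longrightarrow> (\<forall>y\<in>Y. y \<in> I \<or> m y \<in> I) \<Longrightarrow> y \<in> I"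
    using assms(2) unfolding forced_def by blast
  have "card (X \<union> Y) \<le> n" using X(3) Y(3) assms(4) card_Un_le[of X Y] by linarith
  then obtain I where I: "indep I" "r \<in> I" "\<forall>y\<in>X \<union> Y. y \<in> I \<or> m y \<in> I"
    using assms(3) X Y unfolding consistent_def by (metis finite_UnI le_sup_iff)
  then have "x \<in> I" "y \<in> I" using X(4)[of I] Y(4)[of I] by blast+
  then show ?thesis using I(1) unfolding indep_def by blast
qed

text \<open>Here \<open>S\<close> consists of \<open>r\<close> and the mates of its neighbours, and \<open>L\<close> is the complement of the
  closed neighbourhood of \<open>S\<close>. The mates of the new neighbours \<open>B\<close> of \<open>S\<close> lie in \<open>L\<close>.\<close>

lemma consistent_structure:
  assumes fV: "finite V" and tf: "triangle_free V"
    and max: "\<forall>I\<subseteq>V. indep I \<longrightarrow> card I \<le> p"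
    and r: "r \<in> V" "r \<notin> W" and W: "W \<subseteq> V" "V - W \<subseteq> insert r (nb V r)"
    and m: "matching W m" and con: "consistent W m r 3"
  obtains b L where "L \<subseteq> V"
    "card V = 1 + card (nb V r \<inter> W) + card (nb V r) + b + card L" "b \<le> card L"
    "\<forall>X\<subseteq>L. indep X \<longrightarrow> card X + card (nb V r \<inter> W) + 1 \<le> p"
    "consistent W m r 4 \<longrightarrow> 1 + card (nb V r \<inter> W) + b \<le> p"
proof -
  have fW: "finite W" using W fV finite_subset by blast
  let ?N = "nb V r"
  define D where "D = m ` (?N \<inter> W)"
  define B where "B = {x \<in> V - ?N. \<exists>y\<in>D. R y x}"
  define S where "S = insert r D"
  define L where "L = V - (S \<union> ?N \<union> B)"
  have mW: "m x \<in> W" "R x (m x)" "m (m x) = x" if "x \<in> W" for x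
    using m that unfolding matching_def by auto
  have DW: "D \<subseteq> W" unfolding D_def using mW by blast
  have rD: "r \<notin> D" using DW r by blast
  have ND: "?N \<inter> S = {}"
    using tf mW W r R_irrefl unfolding S_def D_def nb_def triangle_free_def by blast
  have rB: "r \<notin> B"
  proof
    assume "r \<in> B"
    then obtain y where "y \<in> D" "R y r" unfolding B_def by blast
    then have "y \<in> ?N \<inter> S" using R_sym DW W unfolding nb_def S_def by blast
    then show False using ND by blast
  qed
  have BW: "B \<subseteq> W" using W(2) rB unfolding B_def by blast
  \<comment> \<open>Forcing costs one edge on \<open>D\<close> and two on the mates of
    \<open>B\<close>. So 3-consistency separates \<open>S\<close> from these mates, and
    4-consistency makes the mates independent.\<close>
  have fD: "forced W m r 1 y" if "y \<in> D" for y
    using that forced_step[OF forced_root] unfolding D_def nb_def by auto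
  have fB: "forced W m r 2 (m x)" if x: "x \<in> B" for x
  proof -
    obtain y where y: "y \<in> D" "R y x" using x unfolding B_def by blast
    have "forced W m r (Suc 1) (m x)" using forced_step[OF fD[OF y(1)] y(2)] x BW by blast
    then show ?thesis by (simp add: numeral_2_eq_2)
  qed
  have fS: "forced W m r 1 y" if "y \<in> S" for y
  proof (cases "y = r")
    case True
    then show ?thesis using forced_root[of W m r] unfolding forced_def by (meson le_trans zero_le)
  qed (use fD that S_def in blast)
  have indS: "indep S"
    unfolding indep_def using forced_nonadjacent[OF fS fS con] by simp
  have SB: "m x \<notin> S" if x: "x \<in> B" for x
  proof
    assume "m x \<in> S"
    moreover have "m x \<noteq> r" using mW(1)[of x] BW x r(2) by blast
    ultimately obtain y where y: "y \<in> ?N" "y \<in> W" "m x = m y" unfolding S_def D_def by blast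
    then have "x = y" using mW(3)[of x] mW(3)[of y] BW x by auto
    then show False using y(1) x unfolding B_def by blast
  qed
  have adj: "x \<in> ?N \<union> B" if "x \<in> V" "y \<in> S" "R y x" for x y
  proof (cases "y = r")
    case True
    then show ?thesis using that unfolding nb_def by simp
  next
    case False
    then have "y \<in> D" using that(2) unfolding S_def by simp
    then show ?thesis using that unfolding B_def by blast
  qed
  have mBL: "m ` B \<subseteq> L"
  proof
    fix q assume "q \<in> m ` B"
    then obtain x where x: "x \<in> B" "q = m x" by blast
    have "\<not> R y q" if "y \<in> S" for y
      using forced_nonadjacent[OF fS[OF that] fB[OF x(1)] con] x(2) by simp
    moreover have "q \<in> V" using x BW mW W by blast
    moreover have "q \<notin> S" using SB x by blast
    moreover have "q \<notin> ?N" using calculation(1)[of r] unfolding S_def nb_def by blast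
    moreover have "q \<notin> B" using calculation(1) unfolding S_def B_def by blast
    ultimately show "q \<in> L" unfolding L_def by blast
  qed
  have SBd: "S \<inter> B = {}" using indS unfolding B_def S_def indep_def by auto
  have NS: "V = S \<union> (?N \<union> (B \<union> L))"
    using DW W(1) r(1) unfolding L_def S_def by (auto simp: B_def nb_def)
  have fin: "finite S" "finite ?N" "finite B" "finite L"
    using fW DW finite_subset fV unfolding S_def B_def L_def nb_def by auto
  have inj: "inj_on m B" "inj_on m (?N \<inter> W)"
    using matching_inj[OF m] BW inj_on_subset by blast+
  have cS: "card S = 1 + card (?N \<inter> W)"
  proof -
    have "card D = card (?N \<inter> W)" unfolding D_def using inj(2) by (rule card_image)
    moreover have "finite D" using DW fW finite_subset by blast
    ultimately show ?thesis unfolding S_def using rD by simp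
  qed
  have cB: "card (m ` B) = card B" using inj(1) by (rule card_image)
  have "card V = card S + card ?N + card B + card L"
  proof -
    have "card V = card (S \<union> (?N \<union> (B \<union> L)))" by (rule arg_cong[OF NS])
    also have "\<dots> = card S + card (?N \<union> (B \<union> L))"
      using fin ND SBd unfolding L_def by (intro card_Un_disjoint) auto
    also have "card (?N \<union> (B \<union> L)) = card ?N + card (B \<union> L)"
      using fin unfolding L_def B_def by (intro card_Un_disjoint) auto
    also have "card (B \<union> L) = card B + card L"
      using fin unfolding L_def by (intro card_Un_disjoint) auto
    finally show ?thesis by simp
  qed
  moreover have "card B \<le> card L" using cB mBL fin by (metis card_mono)
  moreover have "card X + card (?N \<inter> W) + 1 \<le> p" if X: "X \<subseteq> L" "indep X" for X
  proof -
    have "indep (S \<union> X)"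
    proof (rule indep_Un[OF indS X(2)])
      fix x y assume "x \<in> S" "y \<in> X"
      then show "\<not> R x y" using adj[of y x] X(1) unfolding L_def by blast
    qed
    moreover have "S \<union> X \<subseteq> V" using X DW W r by (auto simp: L_def S_def)
    ultimately have "card (S \<union> X) \<le> p" using max by blast
    moreover have "card (S \<union> X) = card S + card X"
      using fin X finite_subset unfolding L_def by (intro card_Un_disjoint) auto
    ultimately show ?thesis using cS by simp
  qed
  moreover have "1 + card (?N \<inter> W) + card B \<le> p" if con4: "consistent W m r 4"
  proof -
    have "indep (S \<union> m ` B)"
    proof (rule indep_Un[OF indS])
      show "indep (m ` B)"
        unfolding indep_def using forced_nonadjacent[OF fB fB con4] by fastforce
      show "\<not> R x y" if "x \<in> S" "y \<in> m ` B" for x y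
        using that forced_nonadjacent[OF fS fB con] by fastforce
    qed
    moreover have "S \<union> m ` B \<subseteq> V" using DW W r mBL by (auto simp: L_def S_def)
    ultimately have "card (S \<union> m ` B) \<le> p" using max by blast
    moreover have "card (S \<union> m ` B) = card S + card (m ` B)"
      using fin SB by (intro card_Un_disjoint) auto
    ultimately show ?thesis using cS cB by simp
  qed
  moreover have "L \<subseteq> V" unfolding L_def by blast
  ultimately show thesis using cS by (intro that[of L "card B"]) auto
qed

section \<open>The cases \<open>j = 2\<close> and \<open>j = 3\<close>\<close>

lemma folk_7_2: "folk 7 2 V \<Longrightarrow> 17 \<le> card V"
proof -
  assume V: "folk 7 2 V"
  obtain x y where "folk 7 1 (V - {x, y})" "card (V - {x, y}) + 2 = card V"
    by (rule folk_peel_edge[OF V, of 1]) auto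
  then show "17 \<le> card V" using folk_one_bound[of 7 "V - {x, y}"] by simp
qed

text \<open>The matching edges and \<open>{z}\<close> form a cover by exactly \<open>p + j\<close>
  cliques; those named by \<open>X\<close>, together with \<open>{z}\<close>, are at most
  \<open>p\<close> of them.\<close>

lemma matched_edges_consistent:
  assumes V: "folk p j V" and W: "matching W m" "W \<subseteq> V" "V - W = {z}" and card: "card W div 2 + 1 = p + j"
    and k: "k + 1 \<le> p"
  shows "consistent W m z k"
  unfolding consistent_def
proof (intro allI impI)
  fix X assume X: "X \<subseteq> W" and fX: "finite X \<and> card X \<le> k"
  have fW: "finite W" using W(2) folk_finite[OF V] finite_subset by blast
  let ?E = "\<lambda>X. (\<lambda>v. {v, m v}) ` X"
  have "card (?E W) = card W div 2" using matching_card_edges[OF fW W(1)] by simp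
  moreover have "{z} \<notin> ?E W" using W(1,3) unfolding matching_def by blast
  ultimately have cC: "card (insert {z} (?E W)) = p + j" using fW card by simp
  have "card (insert {z} (?E X)) \<le> Suc (card (?E X))" using fX by (simp add: card_insert_if)
  also have "\<dots> \<le> p" using card_image_le[of X "\<lambda>v. {v, m v}"] fX k by simp
  finally have cE: "card (insert {z} (?E X)) \<le> p" .
  have clq: "clq K" if "K \<in> insert {z} (?E W)" for K
    using that W(1) R_sym unfolding clq_def matching_def by blast
  have cov: "V \<subseteq> \<Union>(insert {z} (?E W))" using W(3) by blast
  obtain I where I: "indep I" "\<And>K. K \<in> insert {z} (?E X) \<Longrightarrow> I \<inter> K \<noteq> {}"
    by (rule tight_cover_transversal[OF V _ clq cov cC _ cE]) (use fW X in auto)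
  have "z \<in> I" using I(2)[of "{z}"] by simp
  moreover have "y \<in> I \<or> m y \<in> I" if "y \<in> X" for y using I(2)[of "{y, m y}"] that by simp
  ultimately show "\<exists>I. indep I \<and> z \<in> I \<and> (\<forall>y\<in>X. y \<in> I \<or> m y \<in> I)" using I(1) by blast
qed

lemma consistent_mono: "consistent W m r k \<Longrightarrow> l \<le> k \<Longrightarrow> consistent W m r l"
  unfolding consistent_def by (meson order_trans)

text \<open>Below 20 vertices a triangle would leave too few for \<open>folk_7_2\<close>. Two peeled
  edges and seven from \<open>indep_injects\<close> then match all vertices but \<open>z\<close>,
  and these 9 edges with \<open>{z}\<close> are 10 = 7 + 3 cliques.\<close>

lemma folk_7_3: 
  assumes V: "folk 7 3 V"
  shows "20 \<le> card V"
proof (rule ccontr)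
  assume "\<not> ?thesis"
  then have small: "card V \<le> 19" by simp
  have fV: "finite V" using V by (rule folk_finite)
  have tf: "triangle_free V"
  proof (rule ccontr)
    assume nt: "\<not> triangle_free V"
    obtain x y z where "folk 7 2 (V - {x, y, z})" "card (V - {x, y, z}) + 3 = card V"
      by (rule folk_peel_triangle[OF V _ nt, of 2]) auto
    then show False using folk_7_2[of "V - {x, y, z}"] small by simp
  qed
  obtain x y where xy: "x \<in> V" "y \<in> V" "R x y" "folk 7 2 (V - {x, y})" "card (V - {x, y}) + 2 = card V"
    by (rule folk_peel_edge[OF V, of 2]) auto
  define V2 where "V2 = V - {x, y}"
  have V2: "folk 7 2 V2" using xy(4) unfolding V2_def .
  obtain x' y' where xy': "x' \<in> V2" "y' \<in> V2" "R x' y'" "folk 7 1 (V2 - {x', y'})"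
    "card (V2 - {x', y'}) + 2 = card V2"
    by (rule folk_peel_edge[OF V2, of 1]) auto
  define V1 where "V1 = V2 - {x', y'}"
  have V1: "folk 7 1 V1" "card V1 + 4 = card V" using xy xy' unfolding V1_def V2_def by simp_all
  have "15 \<le> card V1" using folk_one_bound[OF V1(1)] by simp
  then have cV: "card V = 19" "card V1 = 15" using V1(2) small by simp_all
  have sub: "V1 \<subseteq> V" "V1 \<subseteq> V2" "V2 \<subseteq> V" unfolding V1_def V2_def by blast+
  obtain I where I: "I \<subseteq> V1" "indep I" "card I = 7"
    by (rule folkE[OF V1(1), of "{}"]) auto
  have fI: "finite I" using I(3) by (metis card.infinite zero_neq_numeral)
  obtain f where f: "inj_on f I" "\<And>x. x \<in> I \<Longrightarrow> f x \<in> V1 - I \<and> R x (f x)"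
    using indep_injects[OF V1(1) I(1,2)] by blast
  define W1 where "W1 = I \<union> f ` I"
  have W1: "W1 \<subseteq> V1" using I f unfolding W1_def by blast
  have cW1: "card W1 = 14"
    using I(3) f fI unfolding W1_def by (subst card_Un_disjoint) (auto simp: card_image)
  have "\<exists>m. matching W1 m" unfolding W1_def using matching_of_inj[OF f(1)] f(2) by blast
  then have "\<exists>m. matching (W1 \<union> {x', y'}) m"
    using matching_Un[OF _ matching_edge[OF xy'(3)], of W1] W1 unfolding V1_def by blast
  then obtain m1 where m1: "matching (W1 \<union> {x', y'}) m1" by blast
  define W where "W = W1 \<union> {x', y'} \<union> {x, y}"
  have "(W1 \<union> {x', y'}) \<inter> {x, y} = {}" using W1 xy' unfolding V1_def V2_def by blast
  from matching_Un[OF m1 matching_edge[OF xy(3)] this] obtain m where m: "matching W m"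
    unfolding W_def by blast
  have WV: "W \<subseteq> V" using W1 xy xy' unfolding W_def V1_def V2_def by blast
  have VW: "V - W = V1 - W1" using W1 xy xy' unfolding W_def V1_def V2_def by blast
  have "card (V1 - W1) = 1"
    using cV W1 cW1 card_Diff_subset[of W1 V1] sub fV by (simp add: finite_subset)
  then obtain z where z: "V - W = {z}" using VW by (metis card_1_singletonE)
  have "card W + 1 = 19"
    using cV z WV fV card_Diff_subset[of W V] card_mono[OF fV WV]
    by (simp add: finite_subset)
  then have con: "consistent W m z 4"
    using matched_edges_consistent[OF V m WV z, of 4] by simp
  have zV: "z \<in> V" "z \<notin> W" using z by blast+
  let ?d = "card (nb V z)"
  have NW: "nb V z \<inter> W = nb V z" using z R_irrefl[of z] unfolding nb_def by auto
  have VWz: "V - W \<subseteq> insert z (nb V z)" using z by blast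
  have con3: "consistent W m z 3" using con by (rule consistent_mono) simp
  have max: "\<forall>I\<subseteq>V. indep I \<longrightarrow> card I \<le> 7" using folk_le[OF V] by blast
  obtain b L where L0: "L \<subseteq> V" "card V = 1 + card (nb V z \<inter> W) + ?d + b + card L" "b \<le> card L"
    "\<forall>X\<subseteq>L. indep X \<longrightarrow> card X + card (nb V z \<inter> W) + 1 \<le> 7"
    "consistent W m z 4 \<longrightarrow> 1 + card (nb V z \<inter> W) + b \<le> 7"
    by (rule consistent_structure[OF fV tf max zV WV VWz m con3])
  have L: "L \<subseteq> V" "card V = 1 + 2 * ?d + b + card L"
    "\<And>X. X \<subseteq> L \<Longrightarrow> indep X \<Longrightarrow> card X + ?d + 1 \<le> 7" "1 + ?d + b \<le> 7"
    using L0(1,2,4,5) con unfolding NW by simp_all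
  have tfL: "triangle_free L" using tf L(1) by (rule triangle_free_subset)
  have fL: "finite L" using L(1) fV finite_subset by blast
  have "4 \<le> ?d" using folk_degree_ge[OF V zV(1)] by simp
  \<comment> \<open>\<open>L\<close> has independence number at most \<open>6 - ?d\<close>, hence at
    most 5, 2 or 0 vertices. Since also \<open>b \<le> 6 - ?d\<close>, the total
    \<open>1 + 2 * ?d + b + card L\<close> is at most 16.\<close>
  then consider "?d = 4" | "?d = 5" | "?d = 6" using L(4) by linarith
  then show False
  proof cases
    case 1
    have "card L \<le> 5" by (rule triangle_free_card_le_5[OF tfL fL]) (use L(3) 1 in fastforce)
    then show ?thesis using 1 L cV by simp
  next
    case 2
    have "card L \<le> 2" by (rule triangle_free_card_le_2[OF tfL]) (use L(3) 2 in fastforce)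
    then show ?thesis using 2 L cV by simp
  next
    case 3
    have "L = {}"
    proof (rule ccontr)
      assume "L \<noteq> {}"
      then obtain x where "x \<in> L" by blast
      then show False using L(3)[of "{x}"] indep_singleton 3 by simp
    qed
    then show ?thesis using 3 L cV by simp
  qed
qed

subsection \<open>Maximum matchings in triangle-free graphs\<close>

definition maximum_matching :: "'a set \<Rightarrow> 'a set \<Rightarrow> ('a \<Rightarrow> 'a) \<Rightarrow> bool" where
  "maximum_matching V W m \<longleftrightarrow> W \<subseteq> V \<and> matching W m \<and>
     (\<forall>W' m'. W' \<subseteq> V \<and> matching W' m' \<longrightarrow> card W' \<le> card W)"

lemma matchingD:
  assumes "matching W m" "v \<in> W"
  shows "m v \<in> W" "R v (m v)" "m (m v) = v" "m v \<noteq> v"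
  using assms R_irrefl unfolding matching_def by metis+

text \<open>The unmatched vertex moves from \<open>z\<close> to \<open>m n\<close> along the path
  \<open>z\<close>, \<open>n\<close>, \<open>m n\<close>. Sliding first shortens an augmenting path
  by two edges.\<close>

lemma maximum_matching_slide:
  assumes "finite V" and M: "maximum_matching V W m" and z: "z \<in> V - W" and n: "n \<in> W" "R z n"
  shows "maximum_matching V (insert z (W - {m n})) (m(z := n, n := z))"
proof -
  have W: "W \<subseteq> V" "matching W m" using M unfolding maximum_matching_def by auto
  have fW: "finite W" using W(1) assms(1) finite_subset by blast
  have mn: "m n \<in> W" "m n \<noteq> n" "m (m n) = n" using matchingD[OF W(2) n(1)] by auto
  have "card (insert z (W - {m n})) = Suc (card (W - {m n}))"
    using fW z by (intro card_insert_disjoint) auto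
  then have "card (insert z (W - {m n})) = card W" using card_Suc_Diff1[OF fW mn(1)] by simp
  moreover have "matching (insert z (W - {m n})) (m(z := n, n := z))"
    unfolding matching_def
  proof
    fix v assume v: "v \<in> insert z (W - {m n})"
    have zn: "z \<noteq> n" using z n by blast
    consider "v = z" | "v = n" | "v \<in> W" "v \<noteq> z" "v \<noteq> n" "v \<noteq> m n" using v z by blast
    then show "(m(z := n, n := z)) v \<in> insert z (W - {m n}) \<and> R v ((m(z := n, n := z)) v) \<and>
        (m(z := n, n := z)) ((m(z := n, n := z)) v) = v"
    proof cases
      case 1
      then show ?thesis using zn n mn(2) by simp
    next
      case 2
      then show ?thesis using zn n R_sym by simp
    next
      case 3
      have "m v \<noteq> n" using 3 matchingD(3)[OF W(2), of v] mn(3) by metis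
      moreover have "m v \<noteq> m n" using 3 matchingD(3)[OF W(2)] n(1) by metis
      moreover have "m v \<noteq> z" using 3 matchingD(1)[OF W(2)] z by blast
      ultimately show ?thesis using 3 matchingD[OF W(2) 3(1)] by simp
    qed
  qed
  ultimately show ?thesis using M z W(1) unfolding maximum_matching_def by auto
qed

text \<open>The suffixes 1, 3, 5, 7 count the edges of an augmenting path from \<open>z\<close> to
  \<open>z'\<close>, which maximality excludes.\<close>

lemma maximum_matching_no_augment_1:
  assumes "finite V" and M: "maximum_matching V W m" and z: "z \<in> V - W" "z' \<in> V - W" "z \<noteq> z'"
  shows "\<not> R z z'"
proof
  assume R: "R z z'"
  have W: "W \<subseteq> V" "matching W m" using M unfolding maximum_matching_def by auto
  have fW: "finite W" using W(1) assms(1) finite_subset by blast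
  obtain m' where "matching (W \<union> {z, z'}) m'" using matching_Un[OF W(2) matching_edge[OF R]] z by blast
  moreover have "W \<union> {z, z'} \<subseteq> V" using W(1) z by blast
  ultimately have "card (W \<union> {z, z'}) \<le> card W" using M unfolding maximum_matching_def by metis
  then show False using z fW by simp
qed

lemma maximum_matching_no_augment_3:
  assumes "finite V" and M: "maximum_matching V W m" and z: "z \<in> V - W" "z' \<in> V - W" "z \<noteq> z'"
    and n: "n \<in> V" "R z n"
  shows "n \<in> W" "\<not> R (m n) z'"
proof -
  have W: "W \<subseteq> V" "matching W m" using M unfolding maximum_matching_def by auto
  show nW: "n \<in> W"
    using maximum_matching_no_augment_1[OF assms(1) M z(1), of n] n R_irrefl by blast
  show "\<not> R (m n) z'"
  proof (rule maximum_matching_no_augment_1[OF assms(1) maximum_matching_slide[OF assms(1) M z(1) nW n(2)]])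
    show "m n \<in> V - insert z (W - {m n})" "m n \<noteq> z'"
      using matchingD[OF W(2) nW] W(1) z by auto
  qed (use z in auto)
qed

lemma maximum_matching_no_augment_5:
  assumes fV: "finite V" and tf: "triangle_free V"
    and M: "maximum_matching V W m" and z: "z \<in> V - W" "z' \<in> V - W" "z \<noteq> z'"
    and n: "n \<in> V" "R z n" and b: "b \<in> V" "R (m n) b"
  shows "b \<in> W" "\<not> R (m b) z'"
proof -
  have W: "W \<subseteq> V" "matching W m" using M unfolding maximum_matching_def by auto
  note nW = maximum_matching_no_augment_3(1)[OF fV M z n]
  have "b \<noteq> z"
    using tf b n z matchingD[OF W(2) nW] W(1) R_sym unfolding triangle_free_def by (metis DiffE subsetD)
  note S = maximum_matching_slide[OF fV M z(1) nW n(2)]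
  have z': "m n \<in> V - insert z (W - {m n})" "z' \<in> V - insert z (W - {m n})" "m n \<noteq> z'"
    using matchingD[OF W(2) nW] W(1) z by auto
  have "b \<in> W \<and> \<not> R (m b) z'"
  proof (cases "b = n")
    case True
    then show ?thesis using maximum_matching_no_augment_3[OF fV M z n] nW by simp
  next
    case False
    then show ?thesis
      using maximum_matching_no_augment_3[OF fV S z' b] \<open>b \<noteq> z\<close> by auto
  qed
  then show "b \<in> W" "\<not> R (m b) z'" by auto
qed

text \<open>The walk is \<open>z\<close>, \<open>n\<close>, \<open>m n\<close>, \<open>b\<close>,
  \<open>m b\<close>, \<open>c\<close>, \<open>m c\<close>, \<open>z'\<close>. If it returns to
  \<open>n\<close>, a shorter exclusion applies; otherwise it survives the slide.\<close>

lemma maximum_matching_no_augment_7: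
  assumes fV: "finite V" and tf: "triangle_free V"
    and M: "maximum_matching V W m" and z: "z \<in> V - W" "z' \<in> V - W" "z \<noteq> z'"
    and n: "n \<in> V" "R z n" and b: "b \<in> V" "R (m n) b" and c: "c \<in> V" "R (m b) c" "c \<noteq> z"
  shows "\<not> R (m c) z'"
proof -
  have W: "W \<subseteq> V" "matching W m" using M unfolding maximum_matching_def by auto
  note nW = maximum_matching_no_augment_3(1)[OF fV M z n]
  have "b \<noteq> z"
    using tf b n z matchingD[OF W(2) nW] W(1) R_sym unfolding triangle_free_def by (metis DiffE subsetD)
  note S = maximum_matching_slide[OF fV M z(1) nW n(2)]
  have z': "m n \<in> V - insert z (W - {m n})" "z' \<in> V - insert z (W - {m n})" "m n \<noteq> z'"
    using matchingD[OF W(2) nW] W(1) z by auto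
  consider "b = n" | "c = n" | "b \<noteq> n" "c \<noteq> n" by blast
  then show ?thesis
  proof cases
    case 1
    then show ?thesis using maximum_matching_no_augment_5[OF fV tf M z n] c by blast
  next
    case 2
    then show ?thesis using maximum_matching_no_augment_3[OF fV M z n] by blast
  next
    case 3
    have "R ((m(z := n, n := z)) b) c" using c(2) 3 \<open>b \<noteq> z\<close> by simp
    from maximum_matching_no_augment_5(2)[OF fV tf S z' b c(1) this]
    show ?thesis using 3 c(3) by simp
  qed
qed

lemma triangle_free_indep_subset:
  assumes "triangle_free P"
  obtains A where "A \<subseteq> P" "indep A" "finite A" "P \<noteq> {} \<Longrightarrow> 1 \<le> card A" "3 \<le> card P \<Longrightarrow> 2 \<le> card A"
proof (cases "3 \<le> card P")
  case True
  obtain x y where "x \<in> P" "y \<in> P" "x \<noteq> y" "\<not> R x y"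
    using triangle_free_pair[OF assms True] by blast
  then show ?thesis using that[of "{x, y}"] indep_pair by simp
next
  case False
  then show ?thesis
  proof (cases "P = {}")
    case True
    then show ?thesis using that[of "{}"] False by (simp add: indep_def)
  next
    case False
    then obtain x where "x \<in> P" by blast
    then show ?thesis using that[of "{x}"] indep_singleton \<open>\<not> 3 \<le> card P\<close> by simp
  qed
qed

text \<open>The set \<open>S\<close> of vertices lying in two of the sets has no neighbours in the
  union, so it combines with independent subsets of the three remainders. If
  \<open>card S \<le> 2\<close>, each remainder contributes 2 vertices; if \<open>card S\<close> is
  3 or 4, each contributes 1. Both give at least 6, so the remainders are empty.\<close>

lemma three_sets_equal:
  assumes tf: "triangle_free (A \<union> B \<union> C)" and fin: "finite A" "finite B" "finite C"
    and card: "5 \<le> card A" "5 \<le> card B" "5 \<le> card C"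
    and cross: "\<And>x y. x \<in> A \<Longrightarrow> y \<in> B \<Longrightarrow> \<not> R x y" "\<And>x y. x \<in> A \<Longrightarrow> y \<in> C \<Longrightarrow> \<not> R x y"
      "\<And>x y. x \<in> B \<Longrightarrow> y \<in> C \<Longrightarrow> \<not> R x y"
    and max: "\<And>X. X \<subseteq> A \<union> B \<union> C \<Longrightarrow> indep X \<Longrightarrow> card X \<le> 5"
  shows "A = B" "A = C" "indep A" "card A = 5"
proof -
  define S where "S = (A \<inter> B) \<union> (A \<inter> C) \<union> (B \<inter> C)"
  have fS: "finite S" using fin unfolding S_def by simp
  have SD: "\<not> R x y" if "x \<in> S" "y \<in> A \<union> B \<union> C" for x y
    using that cross R_sym unfolding S_def by blast
  have tf': "triangle_free (A - S)" "triangle_free (B - S)" "triangle_free (C - S)"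
    using tf by (auto elim: triangle_free_subset)
  obtain A' where A': "A' \<subseteq> A - S" "indep A'" "finite A'"
      "A - S \<noteq> {} \<Longrightarrow> 1 \<le> card A'" "3 \<le> card (A - S) \<Longrightarrow> 2 \<le> card A'"
    using triangle_free_indep_subset[OF tf'(1)] by blast
  obtain B' where B': "B' \<subseteq> B - S" "indep B'" "finite B'"
      "B - S \<noteq> {} \<Longrightarrow> 1 \<le> card B'" "3 \<le> card (B - S) \<Longrightarrow> 2 \<le> card B'"
    using triangle_free_indep_subset[OF tf'(2)] by blast
  obtain C' where C': "C' \<subseteq> C - S" "indep C'" "finite C'"
      "C - S \<noteq> {} \<Longrightarrow> 1 \<le> card C'" "3 \<le> card (C - S) \<Longrightarrow> 2 \<le> card C'"
    using triangle_free_indep_subset[OF tf'(3)] by blast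
  have indS: "indep S" unfolding indep_def using SD unfolding S_def by blast
  have 1: "indep (B' \<union> C')" using B'(1,2) C'(1,2) cross(3) by (intro indep_Un) auto
  have 2: "indep (A' \<union> (B' \<union> C'))" 
    using A'(1,2) B'(1) C'(1) cross(1,2) by (intro indep_Un[OF _ 1]) blast+
  have "indep (S \<union> (A' \<union> (B' \<union> C')))"
    using A'(1) B'(1) C'(1) SD by (intro indep_Un[OF indS 2]) blast
  then have "card (S \<union> (A' \<union> (B' \<union> C'))) \<le> 5"
    using A'(1) B'(1) C'(1) by (intro max) (auto simp: S_def)
  moreover have "card (B' \<union> C') = card B' + card C'"
    using B' C' unfolding S_def by (intro card_Un_disjoint) auto
  moreover have "card (A' \<union> (B' \<union> C')) = card A' + card (B' \<union> C')"
    using A' B' C' unfolding S_def by (intro card_Un_disjoint) auto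
  moreover have "card (S \<union> (A' \<union> (B' \<union> C'))) = card S + card (A' \<union> (B' \<union> C'))"
    using A' B' C' fS by (intro card_Un_disjoint) auto
  ultimately have sum: "card S + card A' + card B' + card C' \<le> 5" by simp
  have split: "card X \<le> card (X - S) + card S" if "finite X" for X
  proof -
    have "card X \<le> card ((X - S) \<union> S)" using that fS by (intro card_mono) auto
    then show ?thesis using card_Un_le[of "X - S" S] by linarith
  qed
  have empty: "A - S = {} \<and> B - S = {} \<and> C - S = {}"
  proof (cases "card S \<le> 2")
    case True
    then show ?thesis using split[OF fin(1)] card A'(5) sum split[OF fin(2)] split[OF fin(3)] B'(5) C'(5)
      by linarith
  next
    case False
    have S5: "5 \<le> card S"
    proof (rule ccontr)
      assume small: "\<not> ?thesis"
      have ne: "X - S \<noteq> {}" if X: "finite X" "5 \<le> card X" for X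
      proof
        assume e: "X - S = {}"
        have "card X \<le> card S" using split[OF X(1)] unfolding e by simp
        then show False using small X(2) by simp
      qed
      have "A - S \<noteq> {}" "B - S \<noteq> {}" "C - S \<noteq> {}" using ne fin card by blast+
      then show False using A'(4) B'(4) C'(4) sum False by linarith
    qed
    then show ?thesis using sum A'(4) B'(4) C'(4) by linarith
  qed
  have "card S \<le> 5" using sum by simp
  moreover have "A \<subseteq> S" "B \<subseteq> S" "C \<subseteq> S" using empty by auto
  ultimately have "A = S" "B = S" "C = S"
    using card fS card_seteq[of S] by (meson order_trans)+
  then show "A = B" "A = C" "indep A" "card A = 5" using indS \<open>card S \<le> 5\<close> card by auto
qed

lemma maximum_matching_exists:
  assumes "finite V"
  shows "\<exists>W m. maximum_matching V W m"
proof -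
  define P where "P W \<longleftrightarrow> W \<subseteq> V \<and> (\<exists>m. matching W m)" for W
  have "P {}" by (auto simp: matching_def P_def)
  moreover have "card W < Suc (card V)" if "P W" for W
    using that card_mono[OF assms, of W] unfolding P_def by (simp add: less_Suc_eq_le)
  ultimately have "\<exists>W. P W \<and> (\<forall>W'. P W' \<longrightarrow> card W' \<le> card W)"
    by (intro Lattices_Big.ex_has_greatest_nat[of P "{}" card "Suc (card V)"]) auto
  then obtain W where W: "P W" "\<And>W'. P W' \<Longrightarrow> card W' \<le> card W" by blast
  from W(1) obtain m where "W \<subseteq> V" "matching W m" unfolding P_def by blast
  then have "maximum_matching V W m" using W(2) unfolding maximum_matching_def P_def by blast
  then show ?thesis by blast
qed

text \<open>Otherwise, by parity, two vertices \<open>y\<close> and \<open>z\<close> are unmatched.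
  Excluding triangles and augmenting paths, the mates \<open>D y\<close> and \<open>D z\<close> of
  their neighbours are nonadjacent to each other and to \<open>y\<close> and \<open>z\<close>, so
  independent sets of such mates have at most 5 vertices.\<close>

lemma perfect_matching:
  assumes fV: "finite V" and tf: "triangle_free V" and deg: "\<And>v. v \<in> V \<Longrightarrow> 5 \<le> card (nb V v)"
    and max: "\<forall>I\<subseteq>V. indep I \<longrightarrow> card I \<le> 7" and even: "even (card V)" and large: "13 \<le> card V"
  obtains m where "matching V m"
proof -
  obtain W m where M: "maximum_matching V W m" using maximum_matching_exists[OF fV] by blast
  have WV: "W \<subseteq> V" "matching W m" using M unfolding maximum_matching_def by auto
  have fW: "finite W" using WV(1) fV finite_subset by blast
  show thesis
  proof (cases "W = V")
    case True
    then show ?thesis using WV(2) that by blast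
  next
    case False
    have "even (card W)" using matching_card_edges[OF fW WV(2)] by (metis dvd_triv_left)
    moreover have "card V = card W + card (V - W)"
      using WV(1) fV fW by (simp add: card_Diff_subset card_mono)
    ultimately have "even (card (V - W))" using even by simp
    moreover have "card (V - W) \<noteq> 0" using False WV(1) fV by auto
    ultimately have "2 \<le> card (V - W)" by presburger
    then obtain Z where "Z \<subseteq> V - W" "card Z = 2" by (meson obtain_subset_with_card_n)
    then obtain y z where yz: "y \<in> V - W" "z \<in> V - W" "y \<noteq> z" unfolding card_2_iff by blast
    note zy = yz(2,1) yz(3)[symmetric]
    note aug3 = maximum_matching_no_augment_3[OF fV M]
    note aug5 = maximum_matching_no_augment_5[OF fV tf M]
    note aug7 = maximum_matching_no_augment_7[OF fV tf M]
    have maxD: "card X \<le> 7" if "X \<subseteq> V" "indep X" for X using max that by blast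
    have mate: "m a \<in> W" "R a (m a)" "m (m a) = a" if "a \<in> W" for a
      using matchingD[OF WV(2) that] by auto
    have no_triangle: False if "a \<in> V" "b \<in> V" "c \<in> V" "R a b" "R b c" "R a c" for a b c
      using tf that unfolding triangle_free_def by blast
    define D where "D v = m ` nb V v" for v
    have DE: "\<exists>a. a \<in> V \<and> R v a \<and> x = m a" if "x \<in> D v" for x v
      using that unfolding D_def nb_def by blast
    have nbW: "nb V y \<subseteq> W" "nb V z \<subseteq> W"
      using aug3(1)[OF yz] aug3(1)[OF zy] unfolding nb_def by blast+
    have inj: "inj_on m W" using WV(2) by (rule matching_inj)
    have DW: "D v \<subseteq> W" "5 \<le> card (D v)" "finite (D v)" if "v \<in> V" "nb V v \<subseteq> W" for v
    proof -
      show "D v \<subseteq> W" using that(2) mate unfolding D_def by blast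
      then show "finite (D v)" using fW finite_subset by blast
      have "inj_on m (nb V v)" using inj that(2) inj_on_subset by blast
      then show "5 \<le> card (D v)" using deg[OF that(1)] unfolding D_def by (simp add: card_image)
    qed
    have Dy: "D y \<subseteq> W" "5 \<le> card (D y)" "finite (D y)" and Dz: "D z \<subseteq> W" "5 \<le> card (D z)" "finite (D z)"
      using DW nbW yz by auto
    \<comment> \<open>An edge here would close the augmenting path \<open>y\<close>,
      \<open>a'\<close>, \<open>a\<close>, \<open>b\<close>, \<open>b'\<close>,
      \<open>z\<close>.\<close>
    have cross: "\<not> R a b" if a: "a \<in> D y" and b: "b \<in> D z" for a b
    proof
      assume R: "R a b"
      obtain a' where a': "a' \<in> V" "R y a'" "a = m a'" using DE[OF a] by blast
      obtain b' where b': "b' \<in> V" "R z b'" "b = m b'" using DE[OF b] by blast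
      have "b' \<in> W" using nbW b' unfolding nb_def by blast
      have "b \<in> V" using b Dz WV by blast
      then have "\<not> R (m b) z" using aug5(2)[OF yz a'(1,2)] R a'(3) by blast
      then show False using mate(3)[OF \<open>b' \<in> W\<close>] b' R_sym by simp
    qed
    have own: "\<not> R v a" if v: "v \<in> V" "nb V v \<subseteq> W" and a: "a \<in> D v" for v a
    proof
      assume R: "R v a"
      obtain a' where a': "a' \<in> V" "R v a'" "a = m a'" using DE[OF a] by blast
      have "a' \<in> W" using v a' unfolding nb_def by blast
      then show False using no_triangle[of v a' a] v R a' mate[OF \<open>a' \<in> W\<close>] WV(1) by blast
    qed
    have other: "\<not> R z a" if "a \<in> D y" for a
    proof -
      obtain a' where "a' \<in> V" "R y a'" "a = m a'" using DE[OF \<open>a \<in> D y\<close>] by blast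
      then show ?thesis using aug3(2)[OF yz] R_sym by blast
    qed
    have other': "\<not> R y a" if "a \<in> D z" for a
    proof -
      obtain a' where "a' \<in> V" "R z a'" "a = m a'" using DE[OF \<open>a \<in> D z\<close>] by blast
      then show ?thesis using aug3(2)[OF zy] R_sym by blast
    qed
    have nyz: "\<not> R y z" by (rule maximum_matching_no_augment_1[OF fV M yz])
    have yz_add: "indep ({y, z} \<union> X) \<and> card X \<le> 5"
      if X: "X \<subseteq> W" "indep X" "\<And>a. a \<in> X \<Longrightarrow> \<not> R y a \<and> \<not> R z a" for X
    proof
      show ind: "indep ({y, z} \<union> X)" using X by (intro indep_Un indep_pair nyz) auto
      have "{y, z} \<union> X \<subseteq> V" using X(1) WV yz by blast
      then have "card ({y, z} \<union> X) \<le> 7" using ind by (rule maxD)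
      moreover have "card ({y, z} \<union> X) = card {y, z} + card X"
        using X(1) yz fW by (intro card_Un_disjoint) (auto intro: finite_subset)
      ultimately show "card X \<le> 5" using yz(3) by simp
    qed
    show ?thesis
    proof (cases "nb V y \<inter> nb V z = {}")
      case False
      \<comment> \<open>A common neighbour \<open>n\<close> makes \<open>m n\<close> a third vertex
        of the same kind, and \<open>three_sets_equal\<close> applies.\<close>
      have common: "D y = D z \<and> D y = D (m n) \<and> indep (D y) \<and> card (D y) = 5 \<and> nb V (m n) \<subseteq> W"
        if n: "n \<in> nb V y" "n \<in> nb V z" for n
      proof -
        have nV: "n \<in> V" "R y n" "R z n" using n unfolding nb_def by auto
        have nW: "n \<in> W" "m n \<in> W" "m n \<in> V" using n nbW mate WV by blast+
        have sub: "nb V (m n) \<subseteq> W" using aug5(1)[OF yz nV(1,2)] unfolding nb_def by blast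
        note Dn = DW[OF nW(3) sub]
        have yzn: "\<not> R y a \<and> \<not> R z a" if "a \<in> D (m n)" for a
          using DE[OF that] aug5(2)[OF yz nV(1,2)] aug5(2)[OF zy nV(1,3)] R_sym by blast
        have cross_y: "\<not> R a b" if a: "a \<in> D y" and b: "b \<in> D (m n)" for a b
        proof
          assume R: "R a b"
          obtain a' where a': "a' \<in> V" "R y a'" "a = m a'" using DE[OF a] by blast
          obtain b' where b': "b' \<in> V" "R (m n) b'" "b = m b'" using DE[OF b] by blast
          have "a' \<in> W" using nbW a' unfolding nb_def by blast
          have "a \<in> V" "a \<noteq> z" using a Dy WV yz by blast+
          then have "\<not> R (m a) y"
            using aug7[OF zy nV(1,3) b'(1,2), of a] R b'(3) R_sym by blast
          then show False using mate(3)[OF \<open>a' \<in> W\<close>] a' R_sym by simp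
        qed
        have cross_z: "\<not> R a b" if a: "a \<in> D z" and b: "b \<in> D (m n)" for a b
        proof
          assume R: "R a b"
          obtain a' where a': "a' \<in> V" "R z a'" "a = m a'" using DE[OF a] by blast
          obtain b' where b': "b' \<in> V" "R (m n) b'" "b = m b'" using DE[OF b] by blast
          have "a' \<in> W" using nbW a' unfolding nb_def by blast
          have "a \<in> V" "a \<noteq> y" using a Dz WV yz by blast+
          then have "\<not> R (m a) z"
            using aug7[OF yz nV(1,2) b'(1,2), of a] R b'(3) R_sym by blast
          then show False using mate(3)[OF \<open>a' \<in> W\<close>] a' R_sym by simp
        qed
        have tf3: "triangle_free (D y \<union> D z \<union> D (m n))"
          using tf by (rule triangle_free_subset) (use Dy Dz Dn WV in blast)
        have max3: "card X \<le> 5" if "X \<subseteq> D y \<union> D z \<union> D (m n)" "indep X" for X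
        proof -
          have "\<not> R y a \<and> \<not> R z a" if "a \<in> X" for a
            using that \<open>X \<subseteq> _\<close> own[OF _ nbW(1)] own[OF _ nbW(2)] other other' yzn yz by blast
          moreover have "X \<subseteq> W" using \<open>X \<subseteq> _\<close> Dy Dz Dn by blast
          ultimately show ?thesis using yz_add[of X] that(2) by blast
        qed
        show ?thesis
          using three_sets_equal[OF tf3 Dy(3) Dz(3) Dn(3) Dy(2) Dz(2) Dn(2) cross cross_y cross_z max3] sub
          by simp
      qed
      from False obtain n0 where n0: "n0 \<in> nb V y" "n0 \<in> nb V z" by blast
      have D0: "D y = D z" "indep (D y)" "card (D y) = 5" using common[OF n0] by auto
      have nb_eq: "nb V v = nb V y" if "D v = D y" "nb V v \<subseteq> W" for v
        using inj_on_image_eq_iff[OF inj that(2) nbW(1)] that(1) unfolding D_def by blast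
      have nbz: "nb V z = nb V y" by (rule nb_eq) (use D0(1) nbW(2) in auto)
      have nbD: "nb V x = nb V y" if x: "x \<in> D y" for x
      proof -
        obtain n where n: "n \<in> nb V y" "x = m n" using x unfolding D_def by blast
        have "n \<in> nb V z" using n(1) nbz by blast
        then have "D (m n) = D y" "nb V (m n) \<subseteq> W" using common[OF n(1)] by auto
        then show ?thesis using nb_eq[of "m n"] n(2) by blast
      qed
      define I where "I = {y, z} \<union> D y"
      have I: "indep I" unfolding I_def
        using yz_add[OF Dy(1) D0(2)] own[OF _ nbW(1)] other yz by blast
      have "card I = card {y, z} + card (D y)"
        unfolding I_def using Dy yz by (intro card_Un_disjoint) auto
      then have cI: "card I = 7" using D0(3) yz(3) by simp
      have IV: "I \<subseteq> V" using Dy WV yz unfolding I_def by blast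
      \<comment> \<open>All vertices of the independent 7-set \<open>I\<close> have the
        neighbourhood \<open>nb V y\<close>, so any vertex elsewhere could be added to
        \<open>I\<close>. Hence \<open>V\<close> has at most 7 + 5 = 12 vertices.\<close>
      have "V \<subseteq> I \<union> nb V y"
      proof
        fix x assume x: "x \<in> V"
        show "x \<in> I \<union> nb V y"
        proof (rule ccontr)
          assume nx: "x \<notin> I \<union> nb V y"
          have "\<not> R i x" if i: "i \<in> I" for i
          proof -
            have "nb V i = nb V y" using i nbz nbD unfolding I_def by blast
            then show ?thesis using nx x unfolding nb_def by blast
          qed
          then have "indep (I \<union> {x})" by (intro indep_Un I indep_singleton) auto
          then have "card (I \<union> {x}) \<le> 7" using IV x by (intro maxD) auto
          moreover have "card (I \<union> {x}) = 8"
            using cI nx IV fV by (subst card_Un_disjoint) (auto intro: finite_subset)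
          ultimately show False by simp
        qed
      qed
      then have "card V \<le> card (I \<union> nb V y)" 
        using IV fV finite_subset by (intro card_mono) (auto simp: nb_def)
      also have "\<dots> \<le> card I + card (nb V y)" by (rule card_Un_le)
      also have "card (nb V y) = card (D y)"
        unfolding D_def using inj nbW(1) by (metis card_image inj_on_subset)
      finally show ?thesis using cI D0(3) large by simp
    next
      case True
      text \<open>One of the two sets of mates has independence number 2. If it belongs to \<open>u\<close>, every
        neighbour of \<open>u\<close> can be reached from \<open>u\<close> along an alternating path of even length.\<close>
      have sides: False
        if uv: "u \<in> V - W" "v \<in> V - W" "u \<noteq> v" and nbuv: "nb V u \<subseteq> W" "nb V v \<subseteq> W"
          and disj: "nb V u \<inter> nb V v = {}"
          and small: "\<And>X. X \<subseteq> D u \<Longrightarrow> indep X \<Longrightarrow> card X \<le> 2" for u v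
      proof -
        have Du: "D u \<subseteq> W" "5 \<le> card (D u)" "finite (D u)" and Dv: "D v \<subseteq> W" "5 \<le> card (D v)"
          using DW nbuv uv by auto
        have tfuv: "triangle_free (D u)" "triangle_free (D v)"
          using tf by (rule triangle_free_subset, use Du Dv WV in blast)+
        obtain A where A: "A \<subseteq> D v" "indep A" "finite A" "2 \<le> card A"
          by (rule triangle_free_indep_subset[OF tfuv(2)]) (use Dv(2) in auto)
        \<comment> \<open>A vertex isolated in \<open>D u\<close> would form an independent triple
          with a nonadjacent pair of the others.\<close>
        have nbr: "\<exists>b\<in>D u. R b a" if a: "a \<in> D u" for a
        proof (rule ccontr)
          assume iso: "\<not> ?thesis"
          have "card (D u - {a}) = card (D u) - 1" using a Du(3) by simp
          then have "3 \<le> card (D u - {a})" using Du(2) by simp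
          then obtain p q where pq: "p \<in> D u - {a}" "q \<in> D u - {a}" "p \<noteq> q" "\<not> R p q"
            using triangle_free_pair[OF triangle_free_subset[OF tfuv(1)], of "D u - {a}"] by blast
          have "indep ({p, q} \<union> {a})"
            using pq iso by (intro indep_Un indep_pair indep_singleton) auto
          then have "card ({p, q} \<union> {a}) \<le> 2" using pq a by (intro small) auto
          then show False using pq by (auto simp: card_insert_if)
        qed
        \<comment> \<open>Such an edge would close the augmenting walk \<open>u\<close>,
          \<open>b'\<close>, \<open>b\<close>, \<open>m n\<close>, \<open>n\<close>,
          \<open>a\<close>, \<open>a'\<close>, \<open>v\<close>.\<close>
        have nA: "\<not> R n a" if n: "n \<in> nb V u" and a: "a \<in> D v" for n a
        proof
          assume R: "R n a"
          have nV: "n \<in> V" "R u n" "n \<in> W" using n nbuv unfolding nb_def by auto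
          have "m n \<in> D u" using n unfolding D_def by blast
          then obtain b where b: "b \<in> D u" "R b (m n)" using nbr by blast
          obtain b' where b': "b' \<in> V" "R u b'" "b = m b'" using DE[OF b(1)] by blast
          obtain a' where a': "a' \<in> V" "R v a'" "a = m a'" using DE[OF a] by blast
          have aW: "a' \<in> W" using nbuv a' unfolding nb_def by blast
          have mn: "m n \<in> V" "m (m n) = n" using mate nV(3) WV by blast+
          have "R (m b') (m n)" using b(2) b'(3) by simp
          moreover have "R (m (m n)) a" using R mn(2) by simp
          moreover have "a \<in> V" "a \<noteq> u" using a Dv(1) WV uv by blast+
          ultimately have "\<not> R (m a) v"
            using aug7[OF uv b'(1,2) mn(1), of a] by blast
          then show False using mate(3)[OF aW] a' R_sym by simp
        qed
        have nv: "\<not> R v n" if "n \<in> nb V u" for n using that disj unfolding nb_def by blast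
        have vA: "indep ({v} \<union> A)"
          using A own[OF _ nbuv(2)] uv by (intro indep_Un indep_singleton) auto
        \<comment> \<open>At least five neighbours of \<open>u\<close>, the vertex \<open>v\<close>
          and two mates in \<open>A\<close> make an independent set of size 8.\<close>
        have "indep (nb V u \<union> ({v} \<union> A))"
        proof (rule indep_Un[OF _ vA])
          show "indep (nb V u)" using indep_nb[OF tf] uv by blast
          show "\<not> R x a" if "x \<in> nb V u" "a \<in> {v} \<union> A" for x a
            using that nA[OF that(1)] nv[OF that(1)] A(1) R_sym by blast
        qed
        moreover have "nb V u \<union> ({v} \<union> A) \<subseteq> V" using uv A(1) Dv(1) WV unfolding nb_def by blast
        ultimately have "card (nb V u \<union> ({v} \<union> A)) \<le> 7" by (intro maxD)
        moreover have "nb V u \<inter> A = {}"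
        proof -
          have "n \<notin> D v" if n: "n \<in> nb V u" for n
          proof
            assume "n \<in> D v"
            then obtain a' where a': "a' \<in> V" "R v a'" "n = m a'" using DE by blast
            have "a' \<in> W" using nbuv a' unfolding nb_def by blast
            have "n \<in> V" "R u n" using n unfolding nb_def by auto
            then have "\<not> R (m n) v" using aug3(2)[OF uv] by blast
            then show False using mate(3)[OF \<open>a' \<in> W\<close>] a' R_sym by simp
          qed
          then show ?thesis using A(1) by blast
        qed
        then have "card (nb V u \<union> ({v} \<union> A)) = card (nb V u) + card ({v} \<union> A)"
          using A(3) nbuv(1) uv fV by (intro card_Un_disjoint) (auto simp: nb_def)
        moreover have "v \<notin> A" using A(1) Dv(1) uv by blast
        then have "card ({v} \<union> A) = 1 + card A" using A(3) by simp
        ultimately show False using deg[of u] uv A(4) by simp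
      qed
      have "(\<forall>X\<subseteq>D y. indep X \<longrightarrow> card X \<le> 2) \<or> (\<forall>X\<subseteq>D z. indep X \<longrightarrow> card X \<le> 2)"
      proof (rule ccontr)
        assume "\<not> ?thesis"
        then obtain X Y where X: "X \<subseteq> D y" "indep X" "3 \<le> card X" and Y: "Y \<subseteq> D z" "indep Y" "3 \<le> card Y"
          by (auto simp: not_le Suc_le_eq numeral_3_eq_3 numeral_2_eq_2)
        have fin: "finite X" "finite Y" using X Y Dy Dz finite_subset by blast+
        have "X \<inter> Y = {}"
        proof -
          have "a \<notin> D z" if a: "a \<in> D y" for a
          proof
            assume "a \<in> D z"
            then obtain b where b: "b \<in> nb V z" "a = m b" unfolding D_def by blast
            obtain c where c: "c \<in> nb V y" "a = m c" using a unfolding D_def by blast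
            have "b = c" using inj b c nbW unfolding inj_on_def by blast
            then show False using b c True by blast
          qed
          then show ?thesis using X Y by blast
        qed
        then have "card (X \<union> Y) = card X + card Y" using fin by (intro card_Un_disjoint)
        moreover have "indep (X \<union> Y)" using X Y cross by (intro indep_Un) blast+
        moreover have "X \<union> Y \<subseteq> W" using X Y Dy Dz by blast
        moreover have "\<not> R y a \<and> \<not> R z a" if "a \<in> X \<union> Y" for a
          using that X Y own[OF _ nbW(1)] own[OF _ nbW(2)] other other' yz by blast
        ultimately show False using yz_add[of "X \<union> Y"] X Y by simp
      qed
      then show ?thesis
        using sides[OF yz nbW(1,2)] sides[OF zy nbW(2,1)] True by (auto simp: Int_commute)
    qed
  qed
qed

section \<open>The cases \<open>j = 4\<close> and \<open>j = 5\<close>\<close>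

lemma not_consistentE:
  assumes "\<not> consistent W m r k"
  obtains X where "X \<subseteq> W" "finite X" "card X \<le> k"
    "\<forall>I. indep I \<and> r \<in> I \<longrightarrow> (\<exists>y\<in>X. y \<notin> I \<and> m y \<notin> I)"
proof -
  obtain X where "X \<subseteq> W" "finite X" "card X \<le> k"
    "\<not> (\<exists>I. indep I \<and> r \<in> I \<and> (\<forall>y\<in>X. y \<in> I \<or> m y \<in> I))"
    using assms unfolding consistent_def by auto
  then show thesis by (intro that[of X]) auto
qed

text \<open>Below 23 vertices, \<open>V\<close> is triangle-free with 22 vertices, and the 11 = 7 +
  4 edges of a perfect matching form a tight cover. One end of an edge becomes the root, and that
  edge is dropped from the matching.\<close>

lemma folk_7_4:
  assumes V: "folk 7 4 V"
  shows "23 \<le> card V"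
proof (rule ccontr)
  assume "\<not> ?thesis"
  then have small: "card V \<le> 22" by simp
  have fV: "finite V" using V by (rule folk_finite)
  have tf: "triangle_free V"
  proof (rule ccontr)
    assume nt: "\<not> triangle_free V"
    obtain x y z where "folk 7 3 (V - {x, y, z})" "card (V - {x, y, z}) + 3 = card V"
      by (rule folk_peel_triangle[OF V _ nt, of 3]) auto
    then show False using folk_7_3[of "V - {x, y, z}"] small by simp
  qed
  obtain x y where xy: "folk 7 3 (V - {x, y})" "card (V - {x, y}) + 2 = card V"
    by (rule folk_peel_edge[OF V, of 3]) auto
  then have cV: "card V = 22" using folk_7_3[of "V - {x, y}"] small by simp
  have max: "\<forall>I\<subseteq>V. indep I \<longrightarrow> card I \<le> 7" using folk_le[OF V] by blast
  have deg: "5 \<le> card (nb V v)" if "v \<in> V" for v using folk_degree_ge[OF V that] by simp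
  obtain m where m: "matching V m"
    using perfect_matching[OF fV tf deg max] cV by auto
  have "V \<noteq> {}" using cV by auto
  then obtain v where v: "v \<in> V" by blast
  have mv: "m v \<in> V" "m (m v) = v" using matchingD[OF m v] by auto
  let ?W = "V - {v, m v}"
  have W: "matching ?W m"
    unfolding matching_def
  proof
    fix u assume u: "u \<in> ?W"
    then have "m u \<in> V" "R u (m u)" "m (m u) = u" using matchingD[OF m, of u] by auto
    moreover have "m u \<noteq> v" "m u \<noteq> m v" using u calculation(3) mv(2) by auto
    ultimately show "m u \<in> ?W \<and> R u (m u) \<and> m (m u) = u" by blast
  qed
  let ?E = "\<lambda>X. (\<lambda>v. {v, m v}) ` X"
  \<comment> \<open>If three edges refuted each end, these six and \<open>{v, m v}\<close> would be
    at most 7 cliques of the tight cover. Their transversal contains \<open>v\<close> or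
    \<open>m v\<close>, a contradiction.\<close>
  have "consistent ?W m v 3 \<or> consistent ?W m (m v) 3"
  proof (rule ccontr)
    assume "\<not> ?thesis"
    then have inc: "\<not> consistent ?W m v 3" "\<not> consistent ?W m (m v) 3" by auto
    obtain X where X: "X \<subseteq> ?W" "finite X" "card X \<le> 3"
      "\<forall>I. indep I \<and> v \<in> I \<longrightarrow> (\<exists>y\<in>X. y \<notin> I \<and> m y \<notin> I)"
      using inc(1) by (rule not_consistentE)
    obtain Y where Y: "Y \<subseteq> ?W" "finite Y" "card Y \<le> 3"
      "\<forall>I. indep I \<and> m v \<in> I \<longrightarrow> (\<exists>y\<in>Y. y \<notin> I \<and> m y \<notin> I)"
      using inc(2) by (rule not_consistentE)
    have clq: "clq K" if K: "K \<in> ?E V" for K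
    proof -
      obtain x where "x \<in> V" "K = {x, m x}" using K by blast
      then show ?thesis using matchingD(2)[OF m] R_sym unfolding clq_def by blast
    qed
    have cov: "V \<subseteq> \<Union>(?E V)" by blast
    have cC: "card (?E V) = 7 + 4" using matching_card_edges[OF fV m] cV by simp
    have fXY: "finite (insert v (X \<union> Y))" using X Y by simp
    have "card (insert v (X \<union> Y)) \<le> Suc (card (X \<union> Y))" using X Y by (simp add: card_insert_if)
    also have "\<dots> \<le> 7" using card_Un_le[of X Y] X(3) Y(3) by simp
    finally have cE: "card (?E (insert v (X \<union> Y))) \<le> 7"
      using card_image_le[OF fXY, of "\<lambda>v. {v, m v}"] by simp
    obtain I where I: "indep I" "\<And>K. K \<in> ?E (insert v (X \<union> Y)) \<Longrightarrow> I \<inter> K \<noteq> {}"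
      by (rule tight_cover_transversal[OF V _ clq cov cC _ cE]) (use fV v X Y in auto)
    have hit: "y \<in> I \<or> m y \<in> I" if "y \<in> insert v (X \<union> Y)" for y
      using I(2)[of "{y, m y}"] that by blast
    then have "v \<in> I \<or> m v \<in> I" by blast
    then show False
    proof
      assume "v \<in> I"
      then obtain y where "y \<in> X" "y \<notin> I" "m y \<notin> I" using X(4) I(1) by blast
      then show False using hit by blast
    next
      assume "m v \<in> I"
      then obtain y where "y \<in> Y" "y \<notin> I" "m y \<notin> I" using Y(4) I(1) by blast
      then show False using hit by blast
    qed
  qed
  then obtain r where r: "r \<in> V" "{r, m r} = {v, m v}" and con: "consistent ?W m r 3"
    using v mv by (metis insert_commute)
  have rr: "r \<in> V" "r \<notin> ?W" "?W \<subseteq> V" using r by blast+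
  have Rr: "R r (m r)" "m r \<in> V" "m r \<noteq> r" using matchingD[OF m r(1)] by auto
  have VW: "V - ?W \<subseteq> insert r (nb V r)" using r(2) Rr unfolding nb_def by auto
  let ?d = "card (nb V r)"
  obtain b L where L: "L \<subseteq> V" "card V = 1 + card (nb V r \<inter> ?W) + ?d + b + card L" "b \<le> card L"
    "\<forall>X\<subseteq>L. indep X \<longrightarrow> card X + card (nb V r \<inter> ?W) + 1 \<le> 7"
    "consistent ?W m r 4 \<longrightarrow> 1 + card (nb V r \<inter> ?W) + b \<le> 7"
    by (rule consistent_structure[OF fV tf max rr VW W con])
  have "nb V r \<inter> ?W = nb V r - {m r}" using r(2)[symmetric] R_irrefl[of r] unfolding nb_def by auto
  moreover have "m r \<in> nb V r" using Rr unfolding nb_def by simp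
  moreover have "finite (nb V r)" using fV unfolding nb_def by simp
  ultimately have cW: "card (nb V r \<inter> ?W) = ?d - 1" by simp
  have tfL: "triangle_free L" using tf L(1) by (rule triangle_free_subset)
  have fL: "finite L" using L(1) fV finite_subset by blast
  have d: "5 \<le> ?d" "?d \<le> 7" using deg[OF r(1)] max indep_nb[OF tf r(1)] by (auto simp: nb_def)
  have bound: "card X + ?d \<le> 7" if "X \<subseteq> L" "indep X" for X using L(4) that cW d by fastforce
  \<comment> \<open>The neighbour \<open>m r\<close> is outside \<open>?W\<close>, so 22 = 1 +
    (\<open>?d\<close> - 1) + \<open>?d\<close> + \<open>b\<close> + \<open>card L\<close>, where
    \<open>b \<le> card L\<close>. With \<open>card L\<close> at most 5, 2 or 0 the right side is at
    most 20.\<close>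
  have total: "22 \<le> 2 * ?d + 2 * card L" using L(2,3) cV cW d by linarith
  consider "?d = 5" | "?d = 6" | "?d = 7" using d by linarith
  then show False
  proof cases
    case 1
    have "card L \<le> 5" by (rule triangle_free_card_le_5[OF tfL fL]) (use bound 1 in fastforce)
    then show ?thesis using 1 total by simp
  next
    case 2
    have "card L \<le> 2" by (rule triangle_free_card_le_2[OF tfL]) (use bound 2 in fastforce)
    then show ?thesis using 2 total by simp
  next
    case 3
    have "L = {}"
    proof (rule ccontr)
      assume "L \<noteq> {}"
      then obtain x where "x \<in> L" by blast
      then show False using bound[of "{x}"] indep_singleton 3 by simp
    qed
    then show ?thesis using 3 total by simp
  qed
qed

lemma folk_7_5:
  assumes V: "folk 7 5 V"
  shows "25 \<le> card V"
proof -
  obtain x y where "folk 7 4 (V - {x, y})" "card (V - {x, y}) + 2 = card V"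
    by (rule folk_peel_edge[OF V, of 4]) auto
  then show ?thesis using folk_7_4[of "V - {x, y}"] by simp
qed

subsection \<open>Independent neighbourhoods\<close>

text \<open>The neighbourhoods can be covered by \<open>p\<close> cliques, one for each element of \<open>B\<close>. Two common
  neighbours leave room for \<open>u\<close> (together with the surplus vertex \<open>e\<close>) and for \<open>v\<close>.\<close>

lemma two_common_neighbours:
  assumes V: "folk p j V" "p = Suc j" and uv: "u \<in> V" "v \<in> V" "u \<noteq> v" "\<not> R u v"
    and A: "A \<subseteq> nb V u" "indep A" "card A = p" "nb V u \<subseteq> insert e A"
    and B: "B \<subseteq> nb V v" "indep B" "card B = p" "nb V v \<subseteq> insert e B"
    and c: "c \<in> A \<inter> B" "c' \<in> A \<inter> B" "c \<noteq> c'" "clq {u, c, e}"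
  shows False
proof -
  have AV: "A \<subseteq> V" "B \<subseteq> V" using A(1) B(1) unfolding nb_def by auto
  have fin: "finite A" "finite B" using AV folk_finite[OF V(1)] finite_subset by auto
  obtain f where f: "inj_on f (A - B)" "\<And>x. x \<in> A - B \<Longrightarrow> f x \<in> B - A \<and> R x (f x)"
  proof (rule max_indep_matching[OF fin(2) _ A(2) B(2) fin(1)])
    show "card I \<le> card B" if "I \<subseteq> A \<union> B" "indep I" for I
      using folk_le[OF V(1), of I] that AV B(3) by blast
  qed blast
  \<comment> \<open>Equal sizes make \<open>f\<close> onto, so its edges and the singletons of
    \<open>A \<inter> B\<close> cover \<open>A \<union> B\<close> with \<open>p\<close>
    cliques.\<close>
  have "card (A - B) = card (B - A)"
    using A(3) B(3) fin by (metis card_Diff_subset_Int finite_Int inf_commute)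
  then have surj: "f ` (A - B) = B - A"
    using f fin by (intro card_subset_eq) (auto simp: card_image)
  define Q where "Q = insert {u, c, e} (insert {v, c'}
    ((\<lambda>x. {x}) ` (A \<inter> B - {c, c'}) \<union> (\<lambda>x. {x, f x}) ` (A - B)))"
  have Rvc: "R v c'" using c(2) B(1) unfolding nb_def by auto
  have "j + card {u, v} \<le> card Q"
  proof (rule closed_neighbourhood_cover[OF V(1)])
    show "clq K" if K: "K \<in> Q" for K
    proof -
      consider "K = {u, c, e}" | "K = {v, c'}" | x where "K = {x}" | x where "K = {x, f x}" "R x (f x)"
        using K f(2) unfolding Q_def by blast
      then show ?thesis
        using c(4) Rvc R_sym by cases (auto simp: clq_def)
    qed
    show "x \<in> \<Union>Q" if x: "x \<in> V" "x \<in> {u, v} \<or> (\<exists>s\<in>{u, v}. R s x)" for x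
    proof -
      have "x \<in> {u, v, e} \<or> x \<in> A \<or> x \<in> B"
        using x A(4) B(4) unfolding nb_def by blast
      then consider "x \<in> {u, v, e, c, c'}" | "x \<in> A \<inter> B - {c, c'}" | "x \<in> A - B" | "x \<in> f ` (A - B)"
        using surj by blast
      then show ?thesis by cases (auto simp: Q_def)
    qed
    show "finite Q" unfolding Q_def using fin by simp
  qed (use uv indep_pair in auto)
  moreover have "card Q \<le> p"
  proof -
    let ?S = "(\<lambda>x. {x}) ` (A \<inter> B - {c, c'})" and ?P = "(\<lambda>x. {x, f x}) ` (A - B)"
    have f': "finite (?S \<union> ?P)" using fin by simp
    have "card Q \<le> Suc (Suc (card (?S \<union> ?P)))"
      unfolding Q_def using f' by (auto simp: card_insert_if)
    also have "card (?S \<union> ?P) \<le> card ?S + card ?P" by (rule card_Un_le)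
    also have "card ?S \<le> card (A \<inter> B - {c, c'})" using fin by (intro card_image_le) auto
    also have "card (A \<inter> B - {c, c'}) = card (A \<inter> B) - 2"
      using c fin by (subst card_Diff_subset) auto
    also have "card ?P \<le> card (A - B)" using fin by (intro card_image_le) auto
    finally have "card Q \<le> Suc (Suc (card (A \<inter> B) - 2 + card (A - B)))" by simp
    moreover have "card {c, c'} \<le> card (A \<inter> B)" using c fin by (intro card_mono) auto
    then have "2 \<le> card (A \<inter> B)" using c by simp
    moreover have "card (A \<inter> B) + card (A - B) = p"
      using A(3) card_Int_Diff[OF fin(1), of B] by simp
    ultimately show ?thesis by linarith
  qed
  ultimately show False using V(2) uv(3) by simp
qed

lemma indep_nb_card:
  assumes "folk p j V" "p = Suc j" "1 \<le> j" "v \<in> V" "indep (nb V v)"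
  shows "card (nb V v) = p"
proof -
  have "nb V v \<subseteq> V" unfolding nb_def by blast
  then show ?thesis using folk_degree_ge[OF assms(1,4,3)] folk_le[OF assms(1) _ assms(5)] assms(2) by simp
qed

lemma indep_nb_common:
  assumes V: "folk p j V" "p = Suc j" "1 \<le> j" and u: "u \<in> V" "indep (nb V u)" and v: "v \<in> V" "indep (nb V v)"
    and uv: "u \<noteq> v" "\<not> R u v" and x: "x \<in> nb V u" "x \<in> nb V v" and y: "y \<in> nb V u" "y \<in> nb V v"
  shows "x = y"
proof (rule ccontr)
  assume "x \<noteq> y"
  \<comment> \<open>The surplus vertex is here the common neighbour \<open>x\<close> itself.\<close>
  show False
  proof (rule two_common_neighbours[OF V(1,2) u(1) v(1) uv subset_refl u(2) indep_nb_card[OF V u] _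
        subset_refl v(2) indep_nb_card[OF V v]])
    show "clq {u, x, x}" using x R_sym unfolding clq_def nb_def by auto
  qed (use x y \<open>x \<noteq> y\<close> in auto)
qed

text \<open>Two such neighbours of \<open>u\<close> are nonadjacent and, by
  \<open>indep_nb_common\<close>, share only the neighbour \<open>u\<close>. So the sets
  \<open>?T v\<close>, of \<open>p\<close> vertices each, are disjoint and avoid
  \<open>u\<close>.\<close>

lemma few_indep_nb:
  assumes V: "folk p j V" "p = Suc j" "1 \<le> j" and u: "u \<in> V"
  shows "p * card {v \<in> nb V u. indep (nb V v)} + 1 \<le> card V"
proof -
  have fV: "finite V" using V(1) by (rule folk_finite)
  define G where "G = {v \<in> nb V u. indep (nb V v)}"
  have fG: "finite G" unfolding G_def nb_def using fV by simp
  let ?T = "\<lambda>v. insert v (nb V v - {u})"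
  have fnb: "finite (nb V v)" for v using fV unfolding nb_def by simp
  have G: "v \<in> V" "indep (nb V v)" "u \<in> nb V v" "R u v" "v \<noteq> u" if "v \<in> G" for v
    using that u R_sym R_irrefl unfolding G_def nb_def by auto
  have cT: "card (?T v) = p" if "v \<in> G" for v
  proof -
    have "v \<notin> nb V v" using R_irrefl unfolding nb_def by simp
    then have "card (?T v) = Suc (card (nb V v - {u}))" using fnb by simp
    also have "\<dots> = card (nb V v)" using card_Suc_Diff1[OF fnb G(3)[OF that]] .
    finally show ?thesis using indep_nb_card[OF V G(1,2)[OF that]] by simp
  qed
  have disj: "?T v \<inter> ?T w = {}" if vw: "v \<in> G" "w \<in> G" "v \<noteq> w" for v w
  proof -
    have nR: "\<not> R v w"
    proof
      assume "R v w"
      then have "w \<in> nb V v" using G(1)[OF vw(2)] unfolding nb_def by simp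
      then show False using G(2,3)[OF vw(1)] G(4)[OF vw(2)] unfolding indep_def by blast
    qed
    have "x = u" if "x \<in> nb V v" "x \<in> nb V w" for x
      using indep_nb_common[OF V G(1,2)[OF vw(1)] G(1,2)[OF vw(2)] vw(3) nR that] G(3) vw by blast
    moreover have "v \<notin> nb V w" "w \<notin> nb V v" using nR R_sym unfolding nb_def by blast+
    ultimately show ?thesis using vw(3) by blast
  qed
  have "card (\<Union>v\<in>G. ?T v) = (\<Sum>v\<in>G. card (?T v))"
    using fG fnb disj by (intro card_UN_disjoint) auto
  also have "\<dots> = p * card G" using cT by simp
  finally have card: "card (\<Union>v\<in>G. ?T v) = p * card G" .
  have "(\<Union>v\<in>G. ?T v) \<subseteq> V - {u}" using G(1,5) unfolding nb_def by blast
  then have "card (\<Union>v\<in>G. ?T v) \<le> card (V - {u})" using fV by (intro card_mono) auto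
  then have "p * card G \<le> card (V - {u})" unfolding card .
  moreover have "card V = Suc (card (V - {u}))" using card_Suc_Diff1[OF fV u] by simp
  ultimately show ?thesis unfolding G_def by simp
qed

section \<open>The case \<open>j = 6\<close> when one vertex meets all triangles\<close>

text \<open>All of the at least 7 neighbours of a vertex count in \<open>few_indep_nb\<close>, which
  would require 50 vertices.\<close>

lemma folk_7_6_triangle_free:
  assumes V: "folk 7 6 V" and tf: "triangle_free V"
  shows "29 \<le> card V"
proof (rule ccontr)
  assume small: "\<not> ?thesis"
  obtain x where x: "x \<in> V" by (rule folk_peel_edge[OF V, of 5]) auto
  have "v \<in> nb V x \<Longrightarrow> indep (nb V v)" for v using indep_nb[OF tf] unfolding nb_def by blast
  then have "{v \<in> nb V x. indep (nb V v)} = nb V x" by blast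
  then have "7 * card (nb V x) + 1 \<le> card V" using few_indep_nb[OF V _ _ x] by simp
  then show False using folk_degree_ge[OF V x] small by simp
qed

text \<open>If \<open>x\<close> is adjacent to all other vertices, it can be deleted without
  lowering \<open>j\<close>. Otherwise some \<open>v\<close> not adjacent to \<open>x\<close> has 7
  independent neighbours; each has at least 5 neighbours besides \<open>x\<close> and
  \<open>v\<close>, and these sets are disjoint, giving 35 vertices.\<close>

lemma folk_7_6_hub:
  assumes V: "folk 7 6 V" and x: "x \<in> V" and tf: "triangle_free (V - {x})"
  shows "29 \<le> card V"
proof (rule ccontr)
  assume small: "\<not> ?thesis"
  have fV: "finite V" using V by (rule folk_finite)
  have fnb: "finite (nb V v)" for v using fV unfolding nb_def by simp
  note bound = folk_le[OF V]
  have ind': "indep (nb V w - {x})" if "w \<in> V - {x}" for w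
    using tf that unfolding triangle_free_def indep_def nb_def by blast
  have ind: "indep (nb V w)" if "w \<in> V - {x}" "\<not> R w x" for w
  proof -
    have "nb V w - {x} = nb V w" using that(2) unfolding nb_def by blast
    then show ?thesis using ind'[OF that(1)] by simp
  qed
  have card': "card (nb V w - {x}) = 7" if w: "w \<in> V - {x}" "\<not> indep (nb V w)" for w
  proof -
    have wx: "R w x" using ind w by blast
    obtain q where q: "q \<in> nb V w - {x}" "R x q"
      using w(2) ind'[OF w(1)] R_sym R_irrefl unfolding indep_def by blast
    \<comment> \<open>The triangle \<open>{w, x, q}\<close> covers two neighbours of
      \<open>w\<close> at once, so seven neighbours remain even without \<open>x\<close>.\<close>
    let ?Q = "insert {w, x, q} ((\<lambda>y. {y}) ` (nb V w - {x} - {q}))"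
    have "6 + card {w} \<le> card ?Q"
    proof (rule closed_neighbourhood_cover[OF V])
      show "clq K" if "K \<in> ?Q" for K
        using that wx q R_sym unfolding clq_def nb_def by auto
      show "y \<in> \<Union>?Q" if "y \<in> V" "y \<in> {w} \<or> (\<exists>s\<in>{w}. R s y)" for y
        using that unfolding nb_def by auto
    qed (use w indep_singleton fnb in auto)
    also have "card ?Q \<le> Suc (card ((\<lambda>y. {y}) ` (nb V w - {x} - {q})))"
      using fnb by (simp add: card_insert_if)
    also have "\<dots> \<le> Suc (card (nb V w - {x} - {q}))" using fnb by (simp add: card_image_le)
    also have "\<dots> = card (nb V w - {x})" using q fnb by (intro card_Suc_Diff1) auto
    finally have "7 \<le> card (nb V w - {x})" by simp
    moreover have "card (nb V w - {x}) \<le> 7" using ind'[OF w(1)] by (intro bound) (auto simp: nb_def)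
    ultimately show ?thesis by simp
  qed
  show False
  proof (cases "\<forall>v\<in>V - {x}. R v x")
    case True
    have "folk 7 6 (V - {x})"
      unfolding folk_def
    proof (intro conjI allI impI)
      show "finite (V - {x})" using fV by simp
      show "card I \<le> 7" if "I \<subseteq> V - {x}" "indep I" for I using that by (intro bound) auto
      fix Q assume Q: "finite Q \<and> card Q \<le> 6 \<and> (\<forall>K\<in>Q. clq K)"
      \<comment> \<open>Adding \<open>x\<close> to each clique keeps their number; an empty
        \<open>Q\<close> becomes \<open>{{x}}\<close>, so that \<open>x\<close> is always
        removed.\<close>
      define P' where "P' = (if Q = {} then {{x}} else (\<lambda>K. insert x (K \<inter> V)) ` Q)"
      have "card P' \<le> 6" unfolding P'_def using Q card_image_le[of Q] by (auto intro: order_trans)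
      moreover have "clq K" if K: "K \<in> P'" for K
      proof -
        consider "K = {x}" | L where "clq L" "K = insert x (L \<inter> V)"
          using K Q unfolding P'_def by (auto split: if_splits)
        then show ?thesis using True R_sym by cases (auto simp: clq_def)
      qed
      moreover have "finite P'" unfolding P'_def using Q by simp
      ultimately obtain I where I: "I \<subseteq> V" "indep I" "card I = 7" "I \<inter> \<Union>P' = {}"
        using folkE[OF V, of P'] by blast
      have "x \<in> \<Union>P'" "\<Union>Q \<inter> V \<subseteq> \<Union>P'" unfolding P'_def by auto
      then have "I \<subseteq> V - {x}" "I \<inter> \<Union>Q = {}" using I by blast+
      then show "\<exists>I\<subseteq>V - {x}. indep I \<and> card I = 7 \<and> I \<inter> \<Union>Q = {}" using I by blast
    qed
    then have "29 \<le> card (V - {x})" using tf by (rule folk_7_6_triangle_free)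
    then show False using small fV card_mono[of V "V - {x}"] by auto
  next
    case False
    then obtain v where v: "v \<in> V - {x}" "\<not> R v x" by blast
    have vV: "v \<in> V" using v by blast
    have iv: "indep (nb V v)" using ind v by blast
    have cv: "card (nb V v) = 7" by (rule indep_nb_card[OF V _ _ _ iv]) (use v in auto)
    have xv: "x \<notin> nb V v" using v unfolding nb_def by simp
    have common: False
      if u: "u \<in> V - {x}" "u \<noteq> v" "\<not> R u v" and c: "c \<in> nb V u \<inter> nb V v" "c' \<in> nb V u \<inter> nb V v" "c \<noteq> c'"
      for u c c'
    proof (cases "indep (nb V u)")
      case True
      then show ?thesis using indep_nb_common[OF V _ _ _ True vV iv u(2,3)] u(1) c by auto
    next
      case False
      have ux: "R u x" using ind u(1) False by blast
      \<comment> \<open>With \<open>x\<close> as surplus vertex, a common neighbour adjacent to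
        \<open>x\<close> gives the clique \<open>{u, d, x}\<close>.\<close>
      have hub: False if d: "d \<in> nb V u \<inter> nb V v" "d' \<in> nb V u \<inter> nb V v" "d \<noteq> d'" "R d x" for d d'
      proof (rule two_common_neighbours[OF V _ _ vV u(2,3) _ ind'[OF u(1)] card'[OF u(1) False] _
            subset_refl iv cv])
        show "clq {u, d, x}" using d ux R_sym unfolding clq_def nb_def by auto
      qed (use u d xv in auto)
      \<comment> \<open>So \<open>c\<close> and \<open>c'\<close> have independent neighbourhoods,
        and the roles are exchanged: \<open>u\<close> and \<open>v\<close> are two common neighbours
        of \<open>c\<close> and \<open>c'\<close>.\<close>
      have cx: "\<not> R c x" "\<not> R c' x" using hub c by blast+
      have cV: "c \<in> V - {x}" "c' \<in> V - {x}" using c xv unfolding nb_def by auto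
      have "\<not> R c c'" using c iv unfolding indep_def by blast
      moreover have "u \<in> nb V c" "u \<in> nb V c'" "v \<in> nb V c" "v \<in> nb V c'"
        using c u(1) vV R_sym unfolding nb_def by auto
      ultimately show ?thesis
        using indep_nb_common[OF V _ _ _ ind[OF cV(1) cx(1)] _ ind[OF cV(2) cx(2)] c(3), of u v] cV u(2) by auto
    qed
    let ?T = "\<lambda>c. nb V c - {x, v}"
    have cT: "5 \<le> card (?T c)" if "c \<in> nb V v" for c
    proof -
      have "7 \<le> card (nb V c)" using folk_degree_ge[OF V, of c] that unfolding nb_def by simp
      moreover have "card (nb V c) - card {x, v} \<le> card (?T c)" by (rule diff_card_le_card_Diff) simp
      moreover have "card {x, v} \<le> 2" by (simp add: card_insert_if)
      ultimately show ?thesis by linarith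
    qed
    have disj: "?T c \<inter> ?T c' = {}" if c: "c \<in> nb V v" "c' \<in> nb V v" "c \<noteq> c'" for c c'
    proof (rule ccontr)
      assume "\<not> ?thesis"
      then obtain u where u: "u \<in> nb V c" "u \<in> nb V c'" "u \<noteq> x" "u \<noteq> v" by blast
      have uV: "u \<in> V - {x}" using u unfolding nb_def by blast
      have "\<not> R u v"
      proof
        assume "R u v"
        then have "u \<in> nb V v" using uV R_sym unfolding nb_def by blast
        then show False using u(1) c(1) iv unfolding indep_def nb_def by blast
      qed
      moreover have "c \<in> nb V u \<inter> nb V v" "c' \<in> nb V u \<inter> nb V v"
        using c u R_sym unfolding nb_def by auto
      ultimately show False using common uV u(4) c(3) by blast
    qed
    have "7 * 5 \<le> (\<Sum>c\<in>nb V v. card (?T c))"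
      using sum_mono[of "nb V v" "\<lambda>_. 5" "\<lambda>c. card (?T c)"] cT cv by simp
    also have "\<dots> = card (\<Union>c\<in>nb V v. ?T c)"
      using fnb disj by (intro card_UN_disjoint[symmetric]) auto
    also have "\<dots> \<le> card V" using fV by (intro card_mono) (auto simp: nb_def)
    finally show False using small by simp
  qed
qed

subsection \<open>Graphs in which any two triangles meet\<close>

definition triangle :: "'a set \<Rightarrow> 'a set \<Rightarrow> bool" where
  "triangle V T \<longleftrightarrow> T \<subseteq> V \<and> card T = 3 \<and> clq T"

lemma triangle_insert:
  assumes "x \<in> V" "y \<in> V" "z \<in> V" "R x y" "R y z" "R x z"
  shows "triangle V {x, y, z}"
proof -
  have "x \<noteq> y" "y \<noteq> z" "x \<noteq> z" using assms R_irrefl by blast+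
  then show ?thesis using assms R_sym unfolding triangle_def clq_def by auto
qed

lemma triangle_other_vertex:
  assumes "triangle V T" "a \<in> T" "b \<in> T" "a \<noteq> b"
  obtains c where "T = {a, b, c}" "c \<noteq> a" "c \<noteq> b"
proof -
  have "card T = 3" using assms unfolding triangle_def by simp
  then obtain x y z where "T = {x, y, z}" "x \<noteq> y" "y \<noteq> z" "x \<noteq> z" unfolding card_3_iff by blast
  then show thesis using assms that
    by (cases "a = x"; cases "a = y"; cases "b = x"; cases "b = y") (auto simp: insert_commute)
qed

text \<open>Suppose \<open>T\<^sub>1 \<inter> T\<^sub>2 = {c}\<close> and a triangle \<open>T\<^sub>3\<close> avoids \<open>c\<close>. Then \<open>T\<^sub>3\<close> contains \<open>a \<in> T\<^sub>1\<close> and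
  \<open>d \<in> T\<^sub>2\<close>, and a triangle meeting \<open>{c, a, d}\<close> in only one vertex would complete one of the three
  triangles to a clique of size 4.\<close>

lemma pairwise_meeting_triangles:
  assumes meet: "\<And>S T. triangle V S \<Longrightarrow> triangle V T \<Longrightarrow> S \<inter> T \<noteq> {}"
    and K4: "\<And>T x. triangle V T \<Longrightarrow> x \<in> V - T \<Longrightarrow> \<exists>y\<in>T. \<not> R x y"
    and T1: "triangle V T1"
  shows "(\<exists>x. \<forall>T. triangle V T \<longrightarrow> x \<in> T) \<or>
    (\<exists>T. triangle V T \<and> (\<forall>S. triangle V S \<longrightarrow> 2 \<le> card (S \<inter> T)))"
proof (rule ccontr)
  assume neg: "\<not> ?thesis"
  have fin: "finite T" if "triangle V T" for T
    using that unfolding triangle_def by (metis card.infinite zero_neq_numeral)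
  have adj: "R x y" if "triangle V T" "x \<in> T" "y \<in> T" "x \<noteq> y" for T x y
    using that unfolding triangle_def clq_def by blast
  have one: "\<exists>t. S \<inter> T = {t}" if "triangle V S" "triangle V T" "\<not> 2 \<le> card (S \<inter> T)" for S T
  proof -
    have "card (S \<inter> T) \<noteq> 0" using meet[OF that(1,2)] fin[OF that(1)] by simp
    then have "card (S \<inter> T) = 1" using that(3) by linarith
    then show ?thesis by (meson card_1_singletonE)
  qed
  obtain T2 where T2: "triangle V T2" "\<not> 2 \<le> card (T2 \<inter> T1)" using neg T1 by blast
  obtain c where c: "T2 \<inter> T1 = {c}" using one[OF T2(1) T1 T2(2)] by blast
  obtain T3 where T3: "triangle V T3" "c \<notin> T3" using neg by blast
  obtain a where a: "a \<in> T3" "a \<in> T1" using meet[OF T3(1) T1] by blast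
  obtain d where d: "d \<in> T3" "d \<in> T2" using meet[OF T3(1) T2(1)] by blast
  have ac: "a \<noteq> c" "d \<noteq> c" using a d T3(2) by auto
  then have "a \<notin> T2" "d \<notin> T1" using a d c by auto
  then have ne: "a \<noteq> c" "d \<noteq> c" "a \<noteq> d" "a \<notin> T2" "d \<notin> T1" using ac a d by auto
  have cT: "c \<in> T1" "c \<in> T2" using c by blast+
  have V: "a \<in> V" "c \<in> V" "d \<in> V" using a d cT T1 T2 unfolding triangle_def by blast+
  have Rs: "R c a" "R a d" "R c d" using adj[OF T1 cT(1) a(2)] adj[OF T3(1) a(1) d(1)] adj[OF T2(1) cT(2) d(2)] ne by auto
  have Rs': "R a c" "R d a" "R d c" using Rs R_sym by auto
  have T: "triangle V {c, a, d}" by (rule triangle_insert) (use V Rs in auto)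
  then obtain S where S: "triangle V S" "\<not> 2 \<le> card (S \<inter> {c, a, d})" using neg by blast
  obtain t where t: "S \<inter> {c, a, d} = {t}" using one[OF S(1) T S(2)] by blast
  have tS: "t \<in> S" using t by blast
  have oth: "x \<notin> S" if "x \<in> {c, a, d}" "x \<noteq> t" for x using t that by blast
  obtain b where b: "T1 = {c, a, b}" "b \<noteq> c" "b \<noteq> a"
    using triangle_other_vertex[OF T1 cT(1) a(2)] ne(1) by metis
  obtain e where e: "T2 = {c, d, e}" "e \<noteq> c" "e \<noteq> d"
    using triangle_other_vertex[OF T2(1) cT(2) d(2)] ne(2) by metis
  obtain g where g: "T3 = {a, d, g}" "g \<noteq> a" "g \<noteq> d"
    using triangle_other_vertex[OF T3(1) a(1) d(1)] ne(3) by metis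
  \<comment> \<open>\<open>S\<close> misses two of \<open>c\<close>, \<open>a\<close>,
    \<open>d\<close>, so it meets the original triangle through those two in its third vertex, which
    is then adjacent to \<open>t\<close>.\<close>
  consider "t = c" | "t = a" | "t = d" using t by blast
  then show False
  proof cases
    case 1
    then have "c \<in> S" "a \<notin> S" "d \<notin> S" using tS oth[of c] oth[of a] oth[of d] ne by auto
    moreover have "g \<in> S" using meet[OF S(1) T3(1)] calculation g(1) by blast
    moreover have "g \<noteq> c" using T3(2) g(1) by blast
    ultimately have "R c g" using adj[OF S(1)] by blast
    moreover obtain y where "y \<in> T3" "\<not> R c y" using K4[OF T3(1), of c] T3(2) V(2) by blast
    ultimately show False using Rs Rs' g(1) by auto
  next
    case 2
    then have "a \<in> S" "c \<notin> S" "d \<notin> S" using tS oth[of c] oth[of a] oth[of d] ne by auto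
    moreover have "e \<in> S" using meet[OF S(1) T2(1)] calculation e(1) by blast
    moreover have "e \<noteq> a" using ne(4) e(1) by blast
    ultimately have "R a e" using adj[OF S(1)] by blast
    moreover obtain y where "y \<in> T2" "\<not> R a y" using K4[OF T2(1), of a] ne(4) V(1) by blast
    ultimately show False using Rs Rs' e(1) by auto
  next
    case 3
    then have "d \<in> S" "c \<notin> S" "a \<notin> S" using tS oth[of c] oth[of a] oth[of d] ne by auto
    moreover have "b \<in> S" using meet[OF S(1) T1] calculation b(1) by blast
    moreover have "b \<noteq> d" using ne(5) b(1) by blast
    ultimately have "R d b" using adj[OF S(1)] by blast
    moreover obtain y where "y \<in> T1" "\<not> R d y" using K4[OF T1, of d] ne(5) V(3) by blast
    ultimately show False using Rs Rs' b(1) by auto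
  qed
qed

text \<open>Double counting at the set \<open>G\<close> of vertices with independent neighbourhoods.
  Each has 7 neighbours and every vertex sees at most 3 of them, so \<open>card G\<close> is at most
  12. But a vertex outside \<open>T\<close> and \<open>G\<close> is adjacent to exactly two vertices
  of \<open>T\<close>, and each of the three pairs admits at most 3 such vertices, so
  \<open>card G\<close> is at least 25 - 9 = 16.\<close>

lemma folk_7_6_core_triangle:
  assumes V: "folk 7 6 V" and T: "triangle V T" and core: "\<And>S. triangle V S \<Longrightarrow> 2 \<le> card (S \<inter> T)"
    and K4: "\<And>x. x \<in> V - T \<Longrightarrow> \<exists>y\<in>T. \<not> R x y" and cV: "card V = 28"
  shows False
proof -
  have fV: "finite V" using V by (rule folk_finite)
  have fnb: "finite (nb V v)" for v using fV unfolding nb_def by simp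
  have TV: "T \<subseteq> V" "card T = 3" "clq T" using T unfolding triangle_def by auto
  have fT: "finite T" using TV(1) fV finite_subset by blast
  note bound = folk_le[OF V]
  let ?N = "\<lambda>v. nb V v - T"
  have cVT: "card (V - T) = 25" using card_Diff_subset[OF fT TV(1)] cV TV(2) by simp
  have small: "\<not> triangle V S" if "S \<inter> T \<subseteq> {t}" for S t
  proof
    assume "triangle V S"
    then have "2 \<le> card (S \<inter> T)" by (rule core)
    moreover have "card (S \<inter> T) \<le> card {t}" using that by (intro card_mono) auto
    ultimately show False by simp
  qed
  have indN: "indep (?N v)" if v: "v \<in> V - T" for v
    unfolding indep_def
  proof (intro ballI notI)
    fix p q assume pq: "p \<in> ?N v" "q \<in> ?N v" "R p q"
    have "triangle V {v, p, q}" by (rule triangle_insert) (use v pq in \<open>auto simp: nb_def\<close>)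
    then show False using small[of "{v, p, q}" v] v pq by auto
  qed
  have noR: "\<not> R t q" if v: "v \<in> V - T" and t: "t \<in> nb V v \<inter> T" and q: "q \<in> ?N v" for v t q
  proof
    assume "R t q"
    have "triangle V {v, t, q}" by (rule triangle_insert) (use v t q \<open>R t q\<close> in \<open>auto simp: nb_def\<close>)
    then show False using small[of "{v, t, q}" t] v q by auto
  qed
  define A where "A c = {v \<in> V - T. nb V v \<inter> T = T - {c}}" for c
  have ind: "indep (nb V v)" if v: "v \<in> V - T" "\<forall>c\<in>T. v \<notin> A c" for v
    unfolding indep_def
  proof (intro ballI notI)
    fix p q assume pq: "p \<in> nb V v" "q \<in> nb V v" "R p q"
    have "p \<in> T" "q \<in> T"
      using indN[OF v(1)] noR[OF v(1), of p q] noR[OF v(1), of q p] pq R_sym unfolding indep_def by blast+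
    moreover have "p \<noteq> q" using pq R_irrefl by blast
    ultimately obtain c where c: "T = {p, q, c}" "c \<noteq> p" "c \<noteq> q"
      using triangle_other_vertex[OF T] by metis
    have "c \<notin> nb V v" using K4[OF v(1)] c(1) pq unfolding nb_def by blast
    then have "nb V v \<inter> T = T - {c}" using c pq by blast
    then show False using v c(1) unfolding A_def by blast
  qed
  \<comment> \<open>A vertex of \<open>A c\<close> and its 6 neighbours outside \<open>T\<close>
    make 7 vertices. These sets are disjoint, and only 25 vertices lie outside
    \<open>T\<close>.\<close>
  have cA: "card (A c) \<le> 3" if c: "c \<in> T" for c
  proof -
    have "card (T - {c}) = 2" using c TV(2) fT by simp
    then obtain a b where ab: "T - {c} = {a, b}" "a \<noteq> b" unfolding card_2_iff by blast
    have abT: "a \<in> T" "b \<in> T" "R a b" using ab TV(3) unfolding clq_def by blast+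
    have A: "v \<in> V - T" "nb V v \<inter> T = {a, b}" "R v a" "R v b" if "v \<in> A c" for v
      using that ab unfolding A_def nb_def by blast+
    have iA: "indep (insert a (?N v))" if v: "v \<in> A c" for v
    proof -
      have "indep ({a} \<union> ?N v)"
        using indN[OF A(1)[OF v]] noR[OF A(1)[OF v]] A(2)[OF v] by (intro indep_Un indep_singleton) auto
      then show ?thesis by simp
    qed
    have cN: "card (?N v) = 6" if v: "v \<in> A c" for v
    proof -
      have "card (insert a (?N v)) \<le> 7" using iA[OF v] abT(1) TV(1) by (intro bound) (auto simp: nb_def)
      then have "card (?N v) \<le> 6" using abT(1) fnb by simp
      moreover have "6 + card {v} \<le> card (insert {v, a, b} ((\<lambda>y. {y}) ` ?N v))"
      proof (rule closed_neighbourhood_cover[OF V])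
        show "clq K" if "K \<in> insert {v, a, b} ((\<lambda>y. {y}) ` ?N v)" for K
          using that A(3,4)[OF v] abT(3) R_sym unfolding clq_def by auto
        show "y \<in> \<Union>(insert {v, a, b} ((\<lambda>y. {y}) ` ?N v))" if "y \<in> V" "y \<in> {v} \<or> (\<exists>s\<in>{v}. R s y)" for y
        proof -
          have "y = v \<or> y \<in> nb V v \<inter> T \<or> y \<in> ?N v" using that unfolding nb_def by blast
          then show ?thesis using A(2)[OF v] by blast
        qed
      qed (use A(1)[OF v] indep_singleton fnb in auto)
      then have "6 \<le> card ((\<lambda>y. {y}) ` ?N v)" using fnb by (simp add: card_insert_if split: if_splits)
      then have "6 \<le> card (?N v)" using card_image_le[of "?N v" "\<lambda>y. {y}"] fnb by fastforce
      ultimately show ?thesis by simp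
    qed
    have nadj: "\<not> R v w" if vw: "v \<in> A c" "w \<in> A c" for v w
    proof
      assume "R v w"
      have "triangle V {v, w, a}"
        by (rule triangle_insert) (use \<open>R v w\<close> A(1,3)[OF vw(1)] A(1,3)[OF vw(2)] abT(1) TV(1) in auto)
      then show False using small[of "{v, w, a}" a] A(1)[OF vw(1)] A(1)[OF vw(2)] by auto
    qed
    have disj: "insert v (?N v) \<inter> insert w (?N w) = {}" if vw: "v \<in> A c" "w \<in> A c" "v \<noteq> w" for v w
    proof -
      \<comment> \<open>The vertex \<open>a\<close> is shared already, so \<open>q\<close> would be
        a second common neighbour; \<open>b\<close> serves as the surplus vertex.\<close>
      have False if q: "q \<in> ?N v" "q \<in> ?N w" for q
      proof (rule two_common_neighbours[OF V _ _ _ vw(3) nadj[OF vw(1,2)] _ iA[OF vw(1)] _ _ _ iA[OF vw(2)]])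
        show "clq {v, a, b}" using A(3,4)[OF vw(1)] abT(3) R_sym unfolding clq_def by auto
        show "nb V v \<subseteq> insert b (insert a (?N v))" using A(2)[OF vw(1)] by blast
        show "nb V w \<subseteq> insert b (insert a (?N w))" using A(2)[OF vw(2)] by blast
        show "insert a (?N v) \<subseteq> nb V v" using A(2)[OF vw(1)] by blast
        show "insert a (?N w) \<subseteq> nb V w" using A(2)[OF vw(2)] by blast
        show "card (insert a (?N v)) = 7" "card (insert a (?N w)) = 7"
          using cN vw abT(1) fnb by auto
        show "q \<in> insert a (?N v) \<inter> insert a (?N w)" "a \<in> insert a (?N v) \<inter> insert a (?N w)" "a \<noteq> q"
          using q abT(1) by auto
      qed (use A(1)[OF vw(1)] A(1)[OF vw(2)] in auto)
      moreover have "v \<notin> ?N w" "w \<notin> ?N v"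
        using nadj[OF vw(1,2)] R_sym unfolding nb_def by blast+
      ultimately show ?thesis using vw(3) by blast
    qed
    have fA: "finite (A c)" using fV unfolding A_def by simp
    have "card (insert v (?N v)) = 7" if "v \<in> A c" for v
    proof -
      have "v \<notin> ?N v" using R_irrefl unfolding nb_def by blast
      then show ?thesis using cN[OF that] fnb by simp
    qed
    then have "7 * card (A c) = (\<Sum>v\<in>A c. card (insert v (?N v)))" by simp
    also have "\<dots> = card (\<Union>v\<in>A c. insert v (?N v))"
      using fA fnb disj by (intro card_UN_disjoint[symmetric]) auto
    also have "\<dots> \<le> card (V - T)"
      using fV by (intro card_mono) (auto simp: nb_def A_def)
    finally show ?thesis using cVT by simp
  qed
  define G where "G = {v \<in> V. indep (nb V v)}"
  have fG: "finite G" unfolding G_def using fV by simp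
  have "V - T \<subseteq> G \<union> (\<Union>c\<in>T. A c)" using ind unfolding G_def by blast
  then have "25 \<le> card (G \<union> (\<Union>c\<in>T. A c))"
    unfolding cVT[symmetric] using fG fT fV by (intro card_mono) (auto simp: A_def)
  also have "\<dots> \<le> card G + card (\<Union>c\<in>T. A c)" by (rule card_Un_le)
  also have "card (\<Union>c\<in>T. A c) \<le> (\<Sum>c\<in>T. card (A c))" using fT by (rule card_UN_le)
  also have "\<dots> \<le> (\<Sum>c\<in>T. 3)" by (rule sum_mono) (rule cA)
  finally have G16: "16 \<le> card G" using TV(2) by simp
  \<comment> \<open>Four would require \<open>7 * 4 + 1 = 29\<close> vertices.\<close>
  have few: "card {v \<in> G. R v u} \<le> 3" if "u \<in> V" for u
  proof -
    have "{v \<in> G. R v u} = {v \<in> nb V u. indep (nb V v)}" unfolding G_def nb_def using R_sym by blast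
    then show ?thesis using few_indep_nb[OF V _ _ that] cV by simp
  qed
  have "7 * card G = (\<Sum>v\<in>G. card (nb V v))"
  proof -
    have "card (nb V v) = 7" if "v \<in> G" for v
      using indep_nb_card[OF V, of v] that unfolding G_def by simp
    then show ?thesis by simp
  qed
  also have "\<dots> = (\<Sum>v\<in>G. card {u \<in> V. R v u})" unfolding nb_def ..
  also have "\<dots> = (\<Sum>u\<in>V. card {v \<in> G. R v u})"
    using fG fV by (intro sum_multicount_gen) auto
  also have "\<dots> \<le> (\<Sum>u\<in>V. 3)" by (rule sum_mono) (rule few)
  finally show False using G16 cV by simp
qed

section \<open>The case \<open>j = 6\<close> in general, and induction on \<open>j\<close>\<close>

text \<open>On at most 28 vertices, the bounds 25 for \<open>j = 5\<close> and 23 for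
  \<open>j = 4\<close> exclude 4-cliques and disjoint triangles, so
  \<open>pairwise_meeting_triangles\<close> leaves two configurations.\<close>

lemma folk_7_6:
  assumes V: "folk 7 6 V"
  shows "29 \<le> card V"
proof (rule ccontr)
  assume neg: "\<not> ?thesis"
  then have small: "card V \<le> 28" by simp
  have fV: "finite V" using V by (rule folk_finite)
  have peel: "card (V - K) + card K = card V" if "K \<subseteq> V" for K
    using that fV by (metis add.commute card_Diff_subset card_mono finite_subset le_add_diff_inverse)
  have tri25: "folk 7 5 (V - K)" "25 \<le> card (V - K)" if "clq K" for K
  proof -
    show "folk 7 5 (V - K)" by (rule folk_peel) (use V that in auto)
    then show "25 \<le> card (V - K)" by (rule folk_7_5)
  qed
  obtain T0 where T0: "triangle V T0"
  proof -
    have "\<not> triangle_free V" using folk_7_6_triangle_free[OF V] small by auto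
    then obtain x y z where "x \<in> V" "y \<in> V" "z \<in> V" "R x y" "R y z" "R x z"
      unfolding triangle_free_def by blast
    then have "triangle V {x, y, z}" by (rule triangle_insert)
    then show thesis by (rule that)
  qed
  have tri: "T \<subseteq> V" "card T = 3" "clq T" if "triangle V T" for T
    using that unfolding triangle_def by auto
  have cV: "card V = 28"
    using tri25(2)[OF tri(3)[OF T0]] peel[OF tri(1)[OF T0]] tri(2)[OF T0] small by simp
  have K4: "\<exists>y\<in>T. \<not> R x y" if T: "triangle V T" and x: "x \<in> V - T" for T x
  proof (rule ccontr)
    assume all: "\<not> ?thesis"
    have "clq (insert x T)" using all tri(3)[OF T] R_sym unfolding clq_def by blast
    then have "25 \<le> card (V - insert x T)" by (rule tri25(2))
    moreover have "finite T" using tri(1)[OF T] fV finite_subset by blast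
    then have "card (insert x T) = 4" using x tri(2)[OF T] by simp
    moreover have "insert x T \<subseteq> V" using x tri(1)[OF T] by blast
    ultimately show False using peel[of "insert x T"] small by simp
  qed
  have meet: "S \<inter> T \<noteq> {}" if S: "triangle V S" and T: "triangle V T" for S T
  proof
    assume dis: "S \<inter> T = {}"
    have "folk 7 4 (V - S - T)"
      by (rule folk_peel) (use tri25(1)[OF tri(3)[OF S]] tri(3)[OF T] in auto)
    then have "23 \<le> card (V - S - T)" by (rule folk_7_4)
    moreover have "V - S - T = V - (S \<union> T)" by blast
    moreover have "finite S" "finite T" using tri(1)[OF S] tri(1)[OF T] fV finite_subset by blast+
    then have "card (S \<union> T) = 6" using dis tri(2)[OF S] tri(2)[OF T] by (simp add: card_Un_disjoint)
    moreover have "S \<union> T \<subseteq> V" using tri(1)[OF S] tri(1)[OF T] by blast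
    ultimately show False using peel[of "S \<union> T"] small by simp
  qed
  from pairwise_meeting_triangles[OF meet K4 T0]
  consider x where "\<forall>T. triangle V T \<longrightarrow> x \<in> T"
    | T where "triangle V T" "\<forall>S. triangle V S \<longrightarrow> 2 \<le> card (S \<inter> T)"
    by blast
  then show False
  proof cases
    case 1
    then have "x \<in> V" using T0 tri(1)[OF T0] by blast
    moreover have "triangle_free (V - {x})"
      unfolding triangle_free_def
    proof (intro ballI notI)
      fix a b c assume "a \<in> V - {x}" "b \<in> V - {x}" "c \<in> V - {x}" "R a b \<and> R b c \<and> R a c"
      then have "triangle V {a, b, c}" "x \<notin> {a, b, c}" using triangle_insert[of a V b c] by auto
      then show False using 1 by blast
    qed
    ultimately show False using folk_7_6_hub[OF V] small by fastforce
  next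
    case 2
    show False by (rule folk_7_6_core_triangle[OF V 2(1) _ K4[OF 2(1)] cV]) (use 2(2) in auto)
  qed
qed

lemma folk_7_bound:
  assumes "folk 7 j V" "6 \<le> j"
  shows "3 * j + 11 \<le> card V"
  using assms(2,1)
proof (induction j arbitrary: V rule: dec_induct)
  case base
  then show ?case using folk_7_6 by simp
next
  case (step j)
  have nt: "\<not> triangle_free V"
  proof
    assume tf: "triangle_free V"
    obtain x where x: "x \<in> V" by (rule folk_peel_edge[OF step.prems refl]) auto
    have "card (nb V x) \<le> 7"
      using folk_le[OF step.prems _ indep_nb[OF tf x]] unfolding nb_def by blast
    then show False using folk_degree_ge[OF step.prems x] step.hyps by simp
  qed
  obtain x y z where "folk 7 j (V - {x, y, z})" "card (V - {x, y, z}) + 3 = card V"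
    by (rule folk_peel_triangle[OF step.prems refl nt])
  then show ?case using step.IH[of "V - {x, y, z}"] by simp
qed

end

section \<open>From vertex colorings to \<open>folk\<close>\<close>

text \<open>Embed \<open>Q\<close> into a disjoint union with \<open>b i\<close> places for each
  \<open>i\<close> and read off the index.\<close>

lemma split_into_classes:
  fixes b :: "nat \<Rightarrow> nat"
  assumes "finite Q" "finite J" "card Q \<le> (\<Sum>i\<in>J. b i)"
  obtains f where "\<And>K. K \<in> Q \<Longrightarrow> f K \<in> J" "\<And>i. i \<in> J \<Longrightarrow> card {K \<in> Q. f K = i} \<le> b i"
proof -
  have "card (SIGMA i:J. {..<b i}) = (\<Sum>i\<in>J. b i)" using assms(2) by (simp add: card_SigmaI)
  then obtain g where g: "inj_on g Q" "g ` Q \<subseteq> (SIGMA i:J. {..<b i})"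
    using assms card_le_inj[of Q "SIGMA i:J. {..<b i}"] by auto
  have "card {K \<in> Q. fst (g K) = i} \<le> b i" for i
  proof -
    have "inj_on (snd \<circ> g) {K \<in> Q. fst (g K) = i}"
      using g(1) unfolding inj_on_def by (simp add: prod_eq_iff)
    moreover have "(snd \<circ> g) ` {K \<in> Q. fst (g K) = i} \<subseteq> {..<b i}" using g(2) by fastforce
    ultimately show ?thesis by (metis card_inj_on_le card_lessThan finite_lessThan)
  qed
  then show thesis using g(2) by (intro that[of "fst \<circ> g"]) auto
qed

text \<open>A clique of \<open>R\<close> is independent in the graph, so a monochromatic clique of
  the graph meets it at most once. Giving color \<open>i \<noteq> i\<^sub>0\<close> to at most
  \<open>a ! i - 1\<close> members of \<open>Q\<close> blocks that color, and the arrow relation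
  must yield a \<open>p\<close>-clique of color \<open>i\<^sub>0\<close>, which avoids
  \<open>Q\<close>.\<close>

lemma vertex_arrows_folk:
  assumes R: "\<And>x y. R x y \<longleftrightarrow> x \<noteq> y \<and> {x, y} \<notin> E"
    and G: "simple_graph V E" "vertex_arrows V E a" "clique_number V E < Suc p"
    and a: "i\<^sub>0 < length a" "a ! i\<^sub>0 = p" "\<And>i. i < length a \<Longrightarrow> a ! i > 0"
    and j: "(\<Sum>i<length a. a ! i - 1) = j + (p - 1)"
  shows "irreflexive_symmetric.folk R p j V"
proof -
  interpret irreflexive_symmetric R
    by unfold_locales (auto simp: R insert_commute)
  have fV: "finite V" using G(1) unfolding simple_graph_def by blast
  have clique_indep: "clique K E \<longleftrightarrow> indep K" for K
    unfolding clique_def indep_def R by auto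
  define J where "J = {..<length a} - {i\<^sub>0}"
  have sumJ: "(\<Sum>i\<in>J. a ! i - 1) = j"
    using sum.remove[of "{..<length a}" i\<^sub>0 "\<lambda>i. a ! i - 1"] a(1,2) j unfolding J_def by simp
  show ?thesis
    unfolding folk_def
  proof (intro conjI allI impI fV)
    fix I assume I: "I \<subseteq> V" "indep I"
    let ?S = "{card K | K. K \<subseteq> V \<and> clique K E}"
    have "?S \<subseteq> card ` Pow V" by blast
    then have "finite ?S" using fV finite_surj[of "Pow V"] by auto
    moreover have "card I \<in> ?S" using I clique_indep by blast
    ultimately have "card I \<le> Max ?S" by (rule Max_ge)
    then show "card I \<le> p" using G(3) unfolding clique_number_def by simp
  next
    fix Q assume Q: "finite Q \<and> card Q \<le> j \<and> (\<forall>K\<in>Q. clq K)"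
    obtain f where f: "\<And>K. K \<in> Q \<Longrightarrow> f K \<in> J" "\<And>i. i \<in> J \<Longrightarrow> card {K \<in> Q. f K = i} \<le> a ! i - 1"
      using split_into_classes[of Q J "\<lambda>i. a ! i - 1"] Q sumJ unfolding J_def by auto
    define s where "s v = (SOME K. K \<in> Q \<and> v \<in> K)" for v
    have s: "s v \<in> Q \<and> v \<in> s v" if "v \<in> \<Union>Q" for v
      unfolding s_def by (rule someI_ex) (use that in blast)
    define c where "c v = (if v \<in> \<Union>Q then f (s v) else i\<^sub>0)" for v
    have cJ: "c v \<in> {..<length a}" for v
      using f(1)[of "s v"] s[of v] a(1) unfolding c_def J_def by auto
    have "c \<in> V \<rightarrow> {..<length a}" using cJ by auto
    then obtain i K where K: "i < length a" "K \<subseteq> V" "clique K E" "card K = a ! i" "\<forall>v\<in>K. c v = i"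
      using G(2) unfolding vertex_arrows_def by blast
    have cK: "c v = i" if "v \<in> K" for v using K(5) that by blast
    have "i = i\<^sub>0"
    proof (rule ccontr)
      assume "i \<noteq> i\<^sub>0"
      then have iJ: "i \<in> J" using K(1) unfolding J_def by simp
      have "card K \<le> card {L \<in> Q. f L = i}"
      proof (rule indep_card_le_cliques)
        show "indep K" using K(3) clique_indep by blast
        show "K \<subseteq> \<Union>{L \<in> Q. f L = i}"
        proof
          fix v assume v: "v \<in> K"
          have "v \<in> \<Union>Q" using cK[OF v] \<open>i \<noteq> i\<^sub>0\<close> unfolding c_def by (metis (full_types))
          moreover from this have "f (s v) = i" using cK[OF v] unfolding c_def by simp
          ultimately show "v \<in> \<Union>{L \<in> Q. f L = i}" using s[of v] by blast
        qed
      qed (use Q in auto)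
      also have "\<dots> \<le> a ! i - 1" using f(2)[OF iJ] .
      finally show False using K(4) a(3)[OF K(1)] by simp
    qed
    have "K \<inter> \<Union>Q = {}"
    proof (rule ccontr)
      assume "K \<inter> \<Union>Q \<noteq> {}"
      then obtain v where v: "v \<in> K" "v \<in> \<Union>Q" by blast
      then have "f (s v) = i\<^sub>0" using cK[OF v(1)] \<open>i = i\<^sub>0\<close> unfolding c_def by simp
      then show False using f(1)[of "s v"] s[OF v(2)] unfolding J_def by auto
    qed
    then show "\<exists>I\<subseteq>V. indep I \<and> card I = p \<and> I \<inter> \<Union>Q = {}"
      using K \<open>i = i\<^sub>0\<close> a(2) clique_indep by blast
  qed
qed

theorem theorem5p1:
  fixes a :: "nat list" and m :: nat
  assumes "a \<noteq> []"
    and "\<forall>i<length a. a ! i > 0"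
    and "Max (set a) = 7"
    and "m = (\<Sum>i<length a. a ! i - 1) + 1"
    and "m \<ge> 13"
  shows "vertex_Folkman a 8 \<ge> enat (3 * m - 10)"
  unfolding vertex_Folkman_def
proof (rule Inf_greatest)
  fix n assume "n \<in> {enat (card V) | (V :: nat set) E.
    simple_graph V E \<and> vertex_arrows V E a \<and> clique_number V E < 8}"
  then obtain V :: "nat set" and E where n: "n = enat (card V)"
    and G: "simple_graph V E" "vertex_arrows V E a" "clique_number V E < 8" by blast
  define R where "R x y \<longleftrightarrow> x \<noteq> y \<and> {x, y} \<notin> E" for x y :: nat
  interpret irreflexive_symmetric R
    by unfold_locales (auto simp: R_def insert_commute)
  have "Max (set a) \<in> set a" using assms(1) by (intro Max_in) auto
  then obtain i where i: "i < length a" "a ! i = 7" using assms(3) by (metis in_set_conv_nth)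
  \<comment> \<open>The sum is \<open>m - 1 = (m - 7) + 6\<close>, so \<open>j = m - 7\<close>; this
    is at least 6, and \<open>3 * (m - 7) + 11 = 3 * m - 10\<close>.\<close>
  have "folk 7 (m - 7) V"
    by (rule vertex_arrows_folk[OF R_def G(1,2) _ i]) (use G(3) assms(2,4,5) in auto)
  then have "3 * (m - 7) + 11 \<le> card V" by (rule folk_7_bound) (use assms(5) in simp)
  then show "enat (3 * m - 10) \<le> n" using n assms(5) by simp
qed

end
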